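(* Let $\nu=\mathcal{GP}_d(m_\nu,k_\nu)\in\mathbb{M}$ and $\Sigma_\nu(x):=k_\nu(x,x)+\mathcal{T}(x)\in\mathbb{R}^{d\times d}$. Let $r\in\{1,\dots,d\}$ and \[ C_r:=\{x\in\mathbb{X}:\operatorname{rank}(\Sigma_\nu(x))=r\}. \] Assume $(x_i,z_i)\to(x,z)$ in $\mathbb{X}\times\mathbb{R}^d$ as $i\to\infty$, with $x_i,x\in C_r$ and $z_i,z\in\mathbb{R}^d$ for $i\in\mathbb{N}$. Then \[ \mathrm{Cond}_{x_i,z_i}(\nu)\xrightarrow[i\to\infty]{}\mathrm{Cond}_{x,z}(\nu). \]
   Context: $(\mathbb{X},\mathfrak{d})$ is a compact metric space, $d\in\mathbb{N}$, $\mathbb{S}=\mathcal{C}(\mathbb{X};\mathbb{R}^d)$ with the supremum norm; $\tau:\mathbb{X}\to\mathbb{R}^{d\times d}$ is a fixed continuous function and $\mathcal{T}(x)=\tau(x)\tau(x)^\top$. $\mathbb{M}$ is the set of Gaussian measures on $\mathbb{S}$ (Borel probability measures all of whose one-dimensional images under bounded linear functionals are, possibly degenerate, Gaussian). Each $\nu\in\mathbb{M}$ is determined by its mean function $m_\nu(x)=\int f(x)\,\nu(df)$ and matrix covariance function $k_\nu(x,y)=\int (f(x)-m_\nu(x))(f(y)-m_\nu(y))^\top\nu(df)$, written $\nu=\mathcal{GP}_d(m_\nu,k_\nu)$. For $x\in\mathbb{X}$, $z\in\mathbb{R}^d$, $\mathrm{Cond}_{x,z}(\nu)=\mathcal{GP}_d(m_1(\cdot;x,z),k_1(\cdot,\cdot;x))$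 where $m_1(y;x,z)=m_\nu(y)+k_\nu(y,x)\Sigma_\nu(x)^\dagger(z-m_\nu(x))$ and $k_1(y,y';x)=k_\nu(y,y')-k_\nu(y,x)\Sigma_\nu(x)^\dagger k_\nu(y',x)^\top$, with $\dagger$ the Moore–Penrose pseudo-inverse (this is the conditional law of $\xi\sim\nu$ given $\xi(x)+\tau(x)U=z$, $U\sim\mathcal{N}_d(0,I_d)$ independent of $\xi$). Convergence $\nu_n\to\nu_\infty$ in $\mathbb{M}$ means $m_{\nu_n}\to m_{\nu_\infty}$ uniformly on $\mathbb{X}$ and $k_{\nu_n}\to k_{\nu_\infty}$ uniformly on $\mathbb{X}\times\mathbb{X}$. *)

theory Defs
  imports "HOL-Probability.Probability"
begin

text \<open>
  Throughout, the index space is a type \<open>'a\<close> of class \<^class>\<open>metric_space\<close> with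
  \<open>compact UNIV\<close>, so that every continuous function on it is bounded and
  \<open>'a \<Rightarrow>\<^sub>C (real ^ 'd)\<close> is the space of all continuous functions with the supremum norm.
\<close>

definition outer :: "real ^ 'm \<Rightarrow> real ^ 'n \<Rightarrow> real ^ 'n ^ 'm" where
  "outer u v = (\<chi> i j. u $ i * v $ j)"

text \<open>Moore--Penrose pseudo-inverse of a real matrix, given by the four Penrose conditions.\<close>

definition is_pinv :: "real ^ 'n ^ 'm \<Rightarrow> real ^ 'm ^ 'n \<Rightarrow> bool" where
  "is_pinv A B \<longleftrightarrow>
     A ** B ** A = A \<and> B ** A ** B = B \<and>
     transpose (A ** B) = A ** B \<and> transpose (B ** A) = B ** A"

definition pinv :: "real ^ 'n ^ 'm \<Rightarrow> real ^ 'm ^ 'n" where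
  "pinv A = (THE B. is_pinv A B)"

lemma is_pinv_unique:
  assumes B: "is_pinv A B" and C: "is_pinv A C"
  shows "B = C"
proof -
  have "A ** B = A ** C ** (A ** B)"
    using C by (simp add: is_pinv_def matrix_mul_assoc)
  also have "\<dots> = transpose (A ** C) ** transpose (A ** B)"
    using B C by (simp add: is_pinv_def)
  also have "\<dots> = transpose (A ** B ** (A ** C))"
    by (simp add: matrix_transpose_mul)
  also have "\<dots> = A ** C"
    using B C by (simp add: is_pinv_def matrix_mul_assoc)
  finally have AB: "A ** B = A ** C" .
  have "B ** A = B ** A ** (C ** A)"
    using C by (metis is_pinv_def matrix_mul_assoc)
  also have "\<dots> = transpose (B ** A) ** transpose (C ** A)"
    using B C by (simp add: is_pinv_def)
  also have "\<dots> = transpose (C ** A ** (B ** A))"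
    by (simp add: matrix_transpose_mul)
  also have "\<dots> = C ** A"
    using B C by (metis is_pinv_def matrix_mul_assoc)
  finally have BA: "B ** A = C ** A" .
  have "B = B ** A ** B" using B by (simp add: is_pinv_def)
  also have "\<dots> = C ** A ** C" using AB BA by (metis matrix_mul_assoc)
  also have "\<dots> = C" using C by (simp add: is_pinv_def)
  finally show ?thesis .
qed

text \<open>Gaussian laws on the real line; the point mass is the degenerate case.\<close>

definition real_gaussian :: "real measure \<Rightarrow> bool" where
  "real_gaussian \<mu> \<longleftrightarrow>
     (\<exists>m. \<mu> = return borel m) \<or>
     (\<exists>m \<sigma>. \<sigma> > 0 \<and> \<mu> = density lborel (\<lambda>t. ennreal (normal_density m \<sigma> t)))"

definition gaussian_measures ::
  "('a::metric_space \<Rightarrow>\<^sub>C (real ^ 'd)) measure set" where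
  "gaussian_measures =
     {\<nu>. prob_space \<nu> \<and> sets \<nu> = sets borel \<and>
         (\<forall>L :: ('a \<Rightarrow>\<^sub>C (real ^ 'd)) \<Rightarrow> real.
            bounded_linear L \<longrightarrow> real_gaussian (distr \<nu> borel L))}"

definition mean_fun ::
  "('a::metric_space \<Rightarrow>\<^sub>C (real ^ 'd)) measure \<Rightarrow> 'a \<Rightarrow> real ^ 'd" where
  "mean_fun \<nu> x = (\<integral>f. apply_bcontfun f x \<partial>\<nu>)"

definition cov_fun ::
  "('a::metric_space \<Rightarrow>\<^sub>C (real ^ 'd)) measure \<Rightarrow> 'a \<Rightarrow> 'a \<Rightarrow> real ^ 'd ^ 'd" where
  "cov_fun \<nu> x y =
     (\<integral>f. outer (apply_bcontfun f x - mean_fun \<nu> x) (apply_bcontfun f y - mean_fun \<nu> y) \<partial>\<nu>)"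

text \<open>
  The Gaussian measure with mean function \<open>m\<close> and covariance function \<open>k\<close>. A Gaussian measure is
  determined by \<open>m\<close> and \<open>k\<close>, so whenever one exists the choice operator selects that one.
\<close>

definition GP ::
  "('a::metric_space \<Rightarrow> real ^ 'd) \<Rightarrow> ('a \<Rightarrow> 'a \<Rightarrow> real ^ 'd ^ 'd) \<Rightarrow>
   ('a \<Rightarrow>\<^sub>C (real ^ 'd)) measure" where
  "GP m k = (SOME \<nu>. \<nu> \<in> gaussian_measures \<and> mean_fun \<nu> = m \<and> cov_fun \<nu> = k)"

definition Sigma_mat ::
  "('a::metric_space \<Rightarrow> real ^ 'd ^ 'd) \<Rightarrow> ('a \<Rightarrow>\<^sub>C (real ^ 'd)) measure \<Rightarrow> 'a \<Rightarrow>
   real ^ 'd ^ 'd" where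
  "Sigma_mat \<tau> \<nu> x = cov_fun \<nu> x x + \<tau> x ** transpose (\<tau> x)"

definition cond_mean ::
  "('a::metric_space \<Rightarrow> real ^ 'd ^ 'd) \<Rightarrow> 'a \<Rightarrow> real ^ 'd \<Rightarrow>
   ('a \<Rightarrow>\<^sub>C (real ^ 'd)) measure \<Rightarrow> 'a \<Rightarrow> real ^ 'd" where
  "cond_mean \<tau> x z \<nu> y =
     mean_fun \<nu> y + (cov_fun \<nu> y x ** pinv (Sigma_mat \<tau> \<nu> x)) *v (z - mean_fun \<nu> x)"

definition cond_cov ::
  "('a::metric_space \<Rightarrow> real ^ 'd ^ 'd) \<Rightarrow> 'a \<Rightarrow>
   ('a \<Rightarrow>\<^sub>C (real ^ 'd)) measure \<Rightarrow> 'a \<Rightarrow> 'a \<Rightarrow> real ^ 'd ^ 'd" where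
  "cond_cov \<tau> x \<nu> y y' =
     cov_fun \<nu> y y' -
     cov_fun \<nu> y x ** pinv (Sigma_mat \<tau> \<nu> x) ** transpose (cov_fun \<nu> y' x)"

definition Cond ::
  "('a::metric_space \<Rightarrow> real ^ 'd ^ 'd) \<Rightarrow> 'a \<Rightarrow> real ^ 'd \<Rightarrow>
   ('a \<Rightarrow>\<^sub>C (real ^ 'd)) measure \<Rightarrow> ('a \<Rightarrow>\<^sub>C (real ^ 'd)) measure" where
  "Cond \<tau> x z \<nu> = GP (cond_mean \<tau> x z \<nu>) (cond_cov \<tau> x \<nu>)"

text \<open>
  Convergence in the set of Gaussian measures. Membership of the sequence and of the limit is part
  of the notion, so a convergence claim about \<^const>\<open>Cond\<close> includes that the conditional laws exist
  as Gaussian measures on the space of continuous functions.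
\<close>

definition gaussian_converges ::
  "(nat \<Rightarrow> ('a::metric_space \<Rightarrow>\<^sub>C (real ^ 'd)) measure) \<Rightarrow>
   ('a \<Rightarrow>\<^sub>C (real ^ 'd)) measure \<Rightarrow> bool" where
  "gaussian_converges \<nu>s \<nu> \<longleftrightarrow>
     range \<nu>s \<subseteq> gaussian_measures \<and> \<nu> \<in> gaussian_measures \<and>
     uniform_limit UNIV (\<lambda>n. mean_fun (\<nu>s n)) (mean_fun \<nu>) sequentially \<and>
     uniform_limit UNIV (\<lambda>n (x, y). cov_fun (\<nu>s n) x y) (\<lambda>(x, y). cov_fun \<nu> x y) sequentially"

definition rank_stratum ::
  "('a::metric_space \<Rightarrow> real ^ 'd ^ 'd) \<Rightarrow> ('a \<Rightarrow>\<^sub>C (real ^ 'd)) measure \<Rightarrow> nat \<Rightarrow> 'a set" where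
  "rank_stratum \<tau> \<nu> r = {x. rank (Sigma_mat \<tau> \<nu> x) = r}"

end

theory Submission
  imports Defs
begin

text \<open>
  Write \<open>m\<close>, \<open>k\<close> for the mean and covariance functions of \<open>\<nu>\<close> and \<open>\<Sigma>\<close> for the map
  \<open>x \<mapsto> k(x,x) + \<tau>(x)\<tau>(x)\<^sup>T\<close>. The parameters of the conditional law at \<open>(x, z)\<close> are obtained from
  \<open>m\<close>, \<open>k\<close>, \<open>z\<close> and the pseudo-inverse of \<open>\<Sigma>(x)\<close> by sums and matrix products. Three facts then give
  the convergence.

  The functions \<open>m\<close> and \<open>k\<close> are continuous. If \<open>y\<^sub>n \<rightarrow> y\<close>, the coordinates of \<open>\<xi>(y\<^sub>n) - \<xi>(y)\<close> are
  Gaussian variables that tend to \<open>0\<close> at every \<open>\<xi>\<close>, hence in probability. A Gaussian variable that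
  is small with probability above \<open>3/4\<close> has a small second moment
  (\<open>real_gaussian_second_moment_le\<close>), so the convergence also holds in the mean square
  (\<open>pointwise_imp_L2_convergence\<close>), and first and second moments converge.

  The pseudo-inverse is continuous along sequences of symmetric matrices of constant rank
  (\<open>tendsto_pinv_constant_rank\<close>). The pseudo-inverses stay bounded, because the limit matrix is
  bounded below on its range and, the rank being constant, a nearby matrix maps that same subspace
  onto its own range. Every cluster point satisfies the four Penrose equations for the limit matrix,
  so it is the pseudo-inverse of the limit.

  The conditional laws exist as measures on the space of continuous functions
  (\<open>conditional_gaussian_exists\<close>). For independent \<open>\<xi> \<sim> \<nu>\<close> and standard normal \<open>U\<close>, and with
  \<open>G(y) = k(y,x)\<Sigma>(x)\<^sup>\<dagger>\<close>, the random function \<open>\<xi>(y) + G(y)(z - \<xi>(x) - \<tau>(x)U)\<close> is Gaussian with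
  the prescribed mean and covariance; this uses only \<open>\<Sigma>\<^sup>\<dagger>\<Sigma>\<Sigma>\<^sup>\<dagger> = \<Sigma>\<^sup>\<dagger>\<close> and the symmetry of \<open>\<Sigma>\<^sup>\<dagger>\<close>.

  Finally, a jointly continuous function of a point of a compact space and of a parameter converges
  uniformly in the point when the parameter converges (\<open>uniform_limit_continuous_parameter\<close>); this
  is applied with parameter \<open>(x, \<Sigma>(x)\<^sup>\<dagger>, z)\<close>.
\<close>

section \<open>Pseudo-inverses of symmetric matrices\<close>

lemma symmetric_inner_swap:
  fixes A :: "real ^ 'n ^ 'n"
  assumes "transpose A = A"
  shows "(A *v u) \<bullet> v = u \<bullet> (A *v v)"
  using assms by (metis dot_lmul_matrix inner_commute vector_transpose_matrix)

text \<open>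
  The kernel of a symmetric matrix is the orthogonal complement of its range. So the matrix is
  injective on its range, and this is where its pseudo-inverse inverts it.
\<close>

lemma symmetric_range_Int_kernel:
  fixes A :: "real ^ 'n ^ 'n"
  assumes sym: "transpose A = A" and v: "v \<in> range ((*v) A)" and Av: "A *v v = 0"
  shows "v = 0"
proof -
  from v obtain w where w: "v = A *v w" by blast
  have "v \<bullet> v = w \<bullet> (A *v v)"
    using symmetric_inner_swap[OF sym, of w v] w by simp
  then show ?thesis using Av by simp
qed

lemma subspace_range_matrix: "subspace (range ((*v) (A :: real ^ 'n ^ 'm)))"
  by (simp add: linear_subspace_image)

text \<open>
  A left inverse \<open>g\<close> of \<open>A\<close> on its range \<open>V\<close> is a two-sided inverse of \<open>A : V \<rightarrow> V\<close>. Then \<open>P = g A\<close> is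
  the orthogonal projection onto \<open>V\<close>, and the pseudo-inverse is \<open>g P\<close>: invert on \<open>V\<close>, and map the
  orthogonal complement of \<open>V\<close> to \<open>0\<close>.
\<close>

lemma symmetric_pinv_exists:
  fixes A :: "real ^ 'n ^ 'n"
  assumes sym: "transpose A = A"
  shows "\<exists>B. is_pinv A B"
proof -
  define V where "V = range ((*v) A)"
  have subV: "subspace V" by (simp add: V_def subspace_range_matrix)
  have AV: "A *v u \<in> V" for u by (simp add: V_def)
  have inj: "inj_on ((*v) A) V"
  proof (rule inj_onI)
    fix v w assume vw: "v \<in> V" "w \<in> V" "A *v v = A *v w"
    then have "v - w \<in> range ((*v) A)" using subspace_diff[OF subV] by (simp add: V_def)
    then have "v - w = 0"
      using symmetric_range_Int_kernel[OF sym, of "v - w"] vw(3) by (simp add: matrix_vector_mult_diff_distrib)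
    then show "v = w" by simp
  qed
  obtain g where gV: "g u \<in> V" and g: "linear g" and gA: "\<And>v. v \<in> V \<Longrightarrow> g (A *v v) = v" for u
    using linear_exists_left_inverse_on[OF matrix_vector_mul_linear subV inj] by auto
  have "dim ((*v) A ` V) = dim V"
    using inj subV by (intro dim_image_eq) (auto simp: span_eq_iff[THEN iffD2])
  then have AVV: "(*v) A ` V = V"
    using subV by (intro subspace_dim_equal) (auto simp: V_def linear_subspace_image)
  have Ag: "A *v g v = v" if "v \<in> V" for v
    using that gA AVV by (metis imageE)
  define P where "P u = g (A *v u)" for u
  have PV: "P u = u" if "u \<in> V" for u using gA that by (simp add: P_def)
  have PinV: "P u \<in> V" for u by (simp add: P_def gV)
  have AP: "A *v P u = A *v u" for u using Ag AV by (simp add: P_def)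
  have orth: "(u - P u) \<bullet> v = 0" if "v \<in> V" for u v
  proof -
    from that obtain w where "v = A *v w" by (auto simp: V_def)
    then show ?thesis using symmetric_inner_swap[OF sym, of "u - P u" w] AP
      by (simp add: matrix_vector_mult_diff_distrib)
  qed
  have Psym: "P u \<bullet> v = u \<bullet> P v" for u v
  proof -
    have "u \<bullet> P v = P u \<bullet> P v" "v \<bullet> P u = P v \<bullet> P u"
      using orth[OF PinV, of u v] orth[OF PinV, of v u] by (simp_all add: inner_diff_left)
    then show ?thesis by (simp only: inner_commute)
  qed
  define B where "B = matrix (\<lambda>u. g (P u))"
  have linB: "linear (\<lambda>u. g (P u))"
    unfolding P_def using linear_compose[OF linear_compose[OF matrix_vector_mul_linear[of A] g] g]
    by (simp add: o_def) 
  have B: "B *v u = g (P u)" for u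
    using matrix_works[OF linB[folded linear_matrix_vector_mul_eq]] by (simp add: B_def)
  have ABu: "(A ** B) *v u = P u" for u
    by (simp add: matrix_vector_mul_assoc[symmetric] B Ag PinV)
  have BAu: "(B ** A) *v u = P u" for u
    by (simp add: matrix_vector_mul_assoc[symmetric] B PV AV) (simp add: P_def)
  \<comment> \<open>Both products turn out to be the projection \<open>P\<close>, which is self-adjoint.\<close>
  have symI: "transpose C = C" if "\<And>u. C *v u = P u" for C :: "real ^ 'n ^ 'n"
  proof -
    have "(transpose C *v u) \<bullet> v = (C *v u) \<bullet> v" for u v
    proof -
      have "(transpose C *v u) \<bullet> v = u \<bullet> (C *v v)"
        by (simp add: dot_lmul_matrix)
      then show ?thesis using Psym[of u v] that by simp
    qed
    then have "transpose C *v u = C *v u" for u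
      using vector_eq_rdot by blast
    then show ?thesis by (simp add: matrix_eq)
  qed
  have "A ** B ** A = A"
    by (simp add: matrix_eq matrix_vector_mul_assoc[symmetric] B PV AV) (metis AP P_def)
  moreover have "B ** A ** B = B"
    by (simp add: matrix_eq BAu matrix_vector_mul_assoc[symmetric]) (simp add: B PV PinV Ag)
  ultimately show ?thesis
    using symI[OF ABu] symI[OF BAu] by (auto simp: is_pinv_def)
qed

lemma is_pinv_pinv:
  fixes A :: "real ^ 'n ^ 'n"
  assumes "transpose A = A"
  shows "is_pinv A (pinv A)"
  unfolding pinv_def using symmetric_pinv_exists[OF assms]
  by (metis is_pinv_unique the_equality)

lemma pinv_eqI: "is_pinv A B \<Longrightarrow> pinv A = B"
  unfolding pinv_def using is_pinv_unique by blast

lemma transpose_pinv_symmetric: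
  fixes A :: "real ^ 'n ^ 'n"
  assumes sym: "transpose A = A"
  shows "transpose (pinv A) = pinv A"
proof -
  define B where "B = pinv A"
  have B: "A ** B ** A = A" "B ** A ** B = B" "transpose (A ** B) = A ** B" "transpose (B ** A) = B ** A"
    using is_pinv_pinv[OF sym] by (auto simp: is_pinv_def B_def)
  have AB: "A ** transpose B = B ** A" and BA: "transpose B ** A = A ** B"
    using B(3,4) by (simp_all add: matrix_transpose_mul sym)
  have "transpose B ** A ** transpose B = transpose (B ** A ** B)"
    by (simp add: matrix_transpose_mul sym matrix_mul_assoc)
  then have "is_pinv A (transpose B)"
  proof -
    have "A ** transpose B ** A = A"
      using arg_cong[OF B(1), of transpose] by (simp add: matrix_transpose_mul sym matrix_mul_assoc)
    then show ?thesis using \<open>_ = transpose (B ** A ** B)\<close> B by (simp add: is_pinv_def AB BA)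
  qed
  then have "is_pinv A (transpose (pinv A))" by (simp add: B_def)
  then show ?thesis by (metis pinv_eqI)
qed

lemma symmetric_idempotent_norm_le:
  fixes P :: "real ^ 'n ^ 'n"
  assumes sym: "transpose P = P" and idem: "P ** P = P"
  shows "norm (P *v u) \<le> norm u"
proof -
  have "(norm (P *v u))\<^sup>2 = u \<bullet> (P *v (P *v u))"
    using symmetric_inner_swap[OF sym, of u "P *v u"] by (simp add: power2_norm_eq_inner)
  also have "\<dots> = u \<bullet> (P *v u)" by (simp add: matrix_vector_mul_assoc idem)
  also have "\<dots> \<le> norm u * norm (P *v u)" by (rule norm_cauchy_schwarz)
  finally show ?thesis
    by (metis (no_types) mult_right_le_imp_le norm_ge_zero norm_le_zero_iff order_le_less power2_eq_square)
qed

text \<open>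
  Here \<open>V\<close> is any set that \<open>A\<close> maps onto its range, not necessarily the range itself: along a
  convergent sequence of matrices one subspace \<open>V\<close>, the range of the limit, serves all of them. Write the
  projection of \<open>u\<close> to the range as \<open>A v\<close> with \<open>v \<in> V\<close>; then \<open>B u = B A v\<close>, and \<open>B A\<close> is a projection,
  so \<open>norm (B u) \<le> norm v \<le> norm u / c\<close>.
\<close>

lemma norm_pinv_vector_le:
  fixes A :: "real ^ 'n ^ 'n"
  assumes B: "is_pinv A B"
    and c: "c > 0" and V: "(*v) A ` V = range ((*v) A)"
    and low: "\<And>v. v \<in> V \<Longrightarrow> c * norm v \<le> norm (A *v v)"
  shows "norm (B *v u) \<le> norm u / c"
proof -
  have idem: "(A ** B) ** (A ** B) = A ** B" "(B ** A) ** (B ** A) = B ** A"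
    and sym: "transpose (A ** B) = A ** B" "transpose (B ** A) = B ** A" 
    and BAB: "B ** A ** B = B"
    using B by (auto simp: is_pinv_def matrix_mul_assoc)
  have "(A ** B) *v u \<in> (*v) A ` V" unfolding V by (simp add: matrix_vector_mul_assoc[symmetric])
  then obtain v where v: "v \<in> V" "(A ** B) *v u = A *v v" by auto
  have "B *v u = (B ** A) *v v"
    by (metis BAB matrix_vector_mul_assoc v(2))
  then have "norm (B *v u) \<le> norm v"
    using symmetric_idempotent_norm_le[OF sym(2) idem(2)] by simp
  moreover have "c * norm v \<le> norm u"
    using low[OF v(1)] symmetric_idempotent_norm_le[OF sym(1) idem(1), of u] v(2) by simp
  ultimately show ?thesis using c by (simp add: field_simps) (meson dual_order.trans mult_left_mono less_imp_le)
qed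

lemma norm_matrix_le_entries:
  fixes A :: "real ^ 'n ^ 'm"
  assumes "\<And>i j. \<bar>A $ i $ j\<bar> \<le> b"
  shows "norm A \<le> real CARD('m) * (real CARD('n) * b)"
proof -
  have "norm A \<le> (\<Sum>i\<in>UNIV. norm (A $ i))" by (simp add: norm_vec_def L2_set_le_sum)
  also have "\<dots> \<le> (\<Sum>i\<in>(UNIV::'m set). real CARD('n) * b)"
  proof (rule sum_mono)
    fix i
    have "norm (A $ i) \<le> (\<Sum>j\<in>UNIV. \<bar>A $ i $ j\<bar>)" by (rule norm_le_l1_cart)
    also have "\<dots> \<le> (\<Sum>j\<in>(UNIV::'n set). b)" by (intro sum_mono assms)
    finally show "norm (A $ i) \<le> real CARD('n) * b" by simp
  qed
  finally show ?thesis by simp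
qed

lemma bounded_bilinear_matrix_matrix_mult:
  "bounded_bilinear ((**) :: real ^ 'n ^ 'm \<Rightarrow> real ^ 'p ^ 'n \<Rightarrow> real ^ 'p ^ 'm)"
  by (rule bilinear_conv_bounded_bilinear[THEN iffD1])
    (auto simp: bilinear_def matrix_matrix_mult_def vec_eq_iff sum.distrib sum_distrib_left ring_distribs ac_simps intro!: linearI)

lemma bounded_bilinear_matrix_vector_mult:
  "bounded_bilinear ((*v) :: real ^ 'n ^ 'm \<Rightarrow> real ^ 'n \<Rightarrow> real ^ 'm)"
  by (rule bilinear_conv_bounded_bilinear[THEN iffD1])
    (auto simp: bilinear_def matrix_vector_mult_def vec_eq_iff sum.distrib sum_distrib_left ring_distribs ac_simps intro!: linearI)

lemma bounded_linear_transpose: "bounded_linear (transpose :: real ^ 'n ^ 'm \<Rightarrow> real ^ 'm ^ 'n)"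
  by (auto simp: linear_conv_bounded_linear[symmetric] transpose_def vec_eq_iff intro!: linearI)

lemma bounded_bilinear_outer:
  "bounded_bilinear (outer :: real ^ 'm \<Rightarrow> real ^ 'n \<Rightarrow> real ^ 'n ^ 'm)"
  by (rule bilinear_conv_bounded_bilinear[THEN iffD1])
    (auto simp: bilinear_def outer_def vec_eq_iff algebra_simps intro!: linearI)

text \<open>
  Constancy of the rank bounds the pseudo-inverses: eventually \<open>A i\<close> is injective on the range \<open>V\<close>
  of the limit with a uniform lower bound, and equality of dimensions forces \<open>A i\<close> to map \<open>V\<close> onto its
  own range. For matrices of falling rank this fails, as \<open>1 / t \<rightarrow> \<infinity>\<close> for the \<open>1 \<times> 1\<close> matrices \<open>t\<close> with \<open>t > 0\<close> and \<open>t \<rightarrow> 0\<close>.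
\<close>

lemma tendsto_pinv_constant_rank:
  fixes A :: "nat \<Rightarrow> real ^ 'n ^ 'n"
  assumes lim: "A \<longlonglongrightarrow> A0"
    and sym: "\<And>i. transpose (A i) = A i" and sym0: "transpose A0 = A0"
    and rank: "\<And>i. rank (A i) = rank A0"
  shows "(\<lambda>i. pinv (A i)) \<longlonglongrightarrow> pinv A0"
proof -
  define V where "V = range ((*v) A0)"
  have subV: "subspace V" by (simp add: V_def subspace_range_matrix)
  have "\<forall>v\<in>V. A0 *v v = 0 \<longrightarrow> v = 0"
    unfolding V_def using symmetric_range_Int_kernel[OF sym0] by blast
  from injective_imp_isometric[OF closed_subspace[OF subV] subV matrix_vector_mul_bounded_linear this]
  obtain e where e: "e > 0" "\<And>v. v \<in> V \<Longrightarrow> e * norm v \<le> norm (A0 *v v)" by blast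
  obtain K where K: "K > 0" "\<And>(M :: real^'n^'n) v. norm (M *v v) \<le> norm M * norm v * K"
    using bounded_bilinear.pos_bounded[OF bounded_bilinear_matrix_vector_mult] by blast
  have "eventually (\<lambda>i. dist (A i) A0 < e / (2 * K)) sequentially"
    using lim e(1) K(1) by (intro tendstoD) auto
  then have ev: "\<forall>\<^sub>F i in sequentially. \<forall>v\<in>V. e / 2 * norm v \<le> norm (A i *v v)"
  proof (eventually_elim, intro ballI)
    fix i v assume i: "dist (A i) A0 < e / (2 * K)" and v: "v \<in> V"
    have "norm ((A i - A0) *v v) \<le> norm (A i - A0) * norm v * K" by (rule K)
    also have "\<dots> \<le> e / (2 * K) * norm v * K"
      using i K(1) by (intro mult_right_mono) (auto simp: dist_norm)
    finally have "norm ((A i - A0) *v v) \<le> e / 2 * norm v" using K(1) by (simp add: field_simps)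
    moreover have "A i *v v = A0 *v v + (A i - A0) *v v"
      by (simp add: matrix_vector_mult_diff_rdistrib)
    ultimately show "e / 2 * norm v \<le> norm (A i *v v)"
      using e(2)[OF v] norm_diff_ineq[of "A0 *v v" "(A i - A0) *v v"] by simp
  qed
  define b where "b = real CARD('n) * (real CARD('n) * (2 / e))"
  have bnd: "\<forall>\<^sub>F i in sequentially. pinv (A i) \<in> cball 0 b"
    using ev
  proof eventually_elim
    fix i assume low: "\<forall>v\<in>V. e / 2 * norm v \<le> norm (A i *v v)"
    have "inj_on ((*v) (A i)) V"
    proof (rule inj_onI)
      fix v w assume "v \<in> V" "w \<in> V" "A i *v v = A i *v w"
      then have "e / 2 * norm (v - w) \<le> 0"
        using low[rule_format, OF subspace_diff[OF subV, of v w]]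
        by (simp add: matrix_vector_mult_diff_distrib)
      then show "v = w" using e(1) by (simp add: mult_le_0_iff)
    qed
    then have "dim ((*v) (A i) ` V) = dim V"
      using subV by (intro dim_image_eq) (auto simp: span_eq_iff[THEN iffD2])
    also have "\<dots> = dim (range ((*v) (A i)))"
      using rank[of i] by (simp add: V_def rank_dim_range)
    finally have "(*v) (A i) ` V = range ((*v) (A i))"
      using subV by (intro subspace_dim_equal) (auto simp: linear_subspace_image)
    then have le: "norm (pinv (A i) *v u) \<le> norm u / (e / 2)" for u
      using norm_pinv_vector_le[OF is_pinv_pinv[OF sym], where c="e/2" and V=V] low e(1) by auto
    have "\<bar>pinv (A i) $ j $ k\<bar> \<le> 2 / e" for j k
      using le[of "axis k 1"] component_le_norm_cart[of "pinv (A i) *v axis k 1" j]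
      by (simp add: matrix_vector_mult_basis column_def)
    then show "pinv (A i) \<in> cball 0 b"
      unfolding b_def using norm_matrix_le_entries[of "pinv (A i)" "2 / e"] by (simp add: dist_norm)
  qed
  show ?thesis
  proof (rule ccontr)
    assume "\<not> ?thesis"
    then obtain d where d: "d > 0" and "\<not> (\<forall>\<^sub>F i in sequentially. dist (pinv (A i)) (pinv A0) < d)"
      by (auto simp: tendsto_iff)
    then have freq: "\<exists>\<^sub>F i in sequentially. \<not> dist (pinv (A i)) (pinv A0) < d"
      by (simp add: frequently_def)
    have "\<exists>\<^sub>F i in sequentially. pinv (A i) \<in> cball 0 b \<and> \<not> dist (pinv (A i)) (pinv A0) < d"
      using frequently_eventually_frequently[OF freq bnd] by (simp add: conj_commute)
    then have "infinite {i. pinv (A i) \<in> cball 0 b \<and> \<not> dist (pinv (A i)) (pinv A0) < d}"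
      by (simp add: frequently_cofinite[symmetric] cofinite_eq_sequentially)
    then obtain s :: "nat \<Rightarrow> nat" where s: "strict_mono s"
      "\<And>i. pinv (A (s i)) \<in> cball 0 b \<and> \<not> dist (pinv (A (s i))) (pinv A0) < d"
      using infinite_enumerate by blast
    obtain B t where t: "strict_mono (t :: nat \<Rightarrow> nat)" "(\<lambda>i. pinv (A (s (t i)))) \<longlonglongrightarrow> B"
    proof -
      have "seq_compact (cball (0 :: real ^ 'n ^ 'n) b)" by (simp add: compact_imp_seq_compact)
      then obtain B t where "strict_mono (t :: nat \<Rightarrow> nat)" "((\<lambda>i. pinv (A (s i))) \<circ> t) \<longlonglongrightarrow> B"
        using s(2) by (metis seq_compactE)
      then show ?thesis using that by (simp add: o_def)
    qed
    \<comment> \<open>The Penrose equations pass to the limit along the convergent subsequence.\<close>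
    define A' B' where "A' i = A (s (t i))" and "B' i = pinv (A' i)" for i
    have A': "A' \<longlonglongrightarrow> A0" 
      using LIMSEQ_subseq_LIMSEQ[OF lim strict_mono_o[OF s(1) t(1)]] by (simp add: A'_def[abs_def] o_def)
    have B': "B' \<longlonglongrightarrow> B" using t(2) by (simp add: A'_def[abs_def] B'_def[abs_def])
    have pin: "is_pinv (A' i) (B' i)" for i by (simp add: A'_def B'_def is_pinv_pinv sym)
    note [tendsto_intros] = bounded_bilinear.tendsto[OF bounded_bilinear_matrix_matrix_mult]
       bounded_linear.tendsto[OF bounded_linear_transpose]
    have p: "A' i ** B' i ** A' i = A' i" "B' i ** A' i ** B' i = B' i"
      "transpose (A' i ** B' i) = A' i ** B' i" "transpose (B' i ** A' i) = B' i ** A' i" for i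
      using pin[of i] by (auto simp: is_pinv_def)
    have "(\<lambda>i. A' i ** B' i ** A' i) \<longlonglongrightarrow> A0 ** B ** A0" by (intro tendsto_intros A' B')
    then have "A0 ** B ** A0 = A0" using A' unfolding p by (rule LIMSEQ_unique)
    moreover have "(\<lambda>i. B' i ** A' i ** B' i) \<longlonglongrightarrow> B ** A0 ** B" by (intro tendsto_intros A' B')
    then have "B ** A0 ** B = B" using B' unfolding p by (rule LIMSEQ_unique)
    moreover have AB: "(\<lambda>i. A' i ** B' i) \<longlonglongrightarrow> A0 ** B" and BA: "(\<lambda>i. B' i ** A' i) \<longlonglongrightarrow> B ** A0"
      by (intro tendsto_intros A' B')+
    have "(\<lambda>i. transpose (A' i ** B' i)) \<longlonglongrightarrow> transpose (A0 ** B)" by (intro tendsto_intros A' B')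
    then have "transpose (A0 ** B) = A0 ** B" using AB unfolding p by (rule LIMSEQ_unique)
    moreover have "(\<lambda>i. transpose (B' i ** A' i)) \<longlonglongrightarrow> transpose (B ** A0)" by (intro tendsto_intros A' B')
    then have "transpose (B ** A0) = B ** A0" using BA unfolding p by (rule LIMSEQ_unique)
    ultimately have "is_pinv A0 B" unfolding is_pinv_def by (intro conjI)
    then have "pinv A0 = B" by (rule pinv_eqI)
    then have "\<forall>\<^sub>F i in sequentially. dist (pinv (A (s (t i)))) (pinv A0) < d"
      using tendstoD[OF t(2) d] by simp
    then show False using s(2) unfolding eventually_sequentially by blast
  qed
qed

section \<open>Gaussian laws on the real line\<close>

lemma std_normal_affine_density:
  assumes s: "s \<noteq> 0"
  shows "distr std_normal_distribution borel (\<lambda>t. m + s * t) =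
    density lborel (\<lambda>t. ennreal (normal_density m \<bar>s\<bar> t))"
proof -
  interpret real_distribution std_normal_distribution by (rule real_dist_normal_dist)
  have "distributed std_normal_distribution lborel (\<lambda>t. t) (\<lambda>t. ennreal (std_normal_density t))"
    by (auto simp: distributed_def distr_id2 intro!: measurable_ident_sets)
  from normal_density_affine[OF this, of s m] s
  have "distr std_normal_distribution lborel (\<lambda>t. m + s * t) =
    density lborel (\<lambda>t. ennreal (normal_density m \<bar>s\<bar> t))"
    by (simp add: distributed_def)
  then show ?thesis by (metis distr_cong sets_lborel)
qed

text \<open>
  A normal form that treats degenerate (\<open>s = 0\<close>) and non-degenerate laws alike. The sign of \<open>s\<close> is
  left free.
\<close>

lemma real_gaussian_iff_affine_std_normal:
  "real_gaussian \<mu> \<longleftrightarrow> (\<exists>m s. \<mu> = distr std_normal_distribution borel (\<lambda>t. m + s * t))"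
proof
  interpret real_distribution std_normal_distribution by (rule real_dist_normal_dist)
  have const: "distr std_normal_distribution borel (\<lambda>t. m + 0 * t) = return borel m" for m
    by (simp add: distr_const)
  assume "real_gaussian \<mu>"
  then show "\<exists>m s. \<mu> = distr std_normal_distribution borel (\<lambda>t. m + s * t)"
    unfolding real_gaussian_def
  proof (elim disjE exE conjE)
    fix m assume "\<mu> = return borel m"
    then show ?thesis using const by metis
  next
    fix m s :: real assume "s > 0" "\<mu> = density lborel (\<lambda>t. ennreal (normal_density m s t))"
    then show ?thesis using std_normal_affine_density[of s m] by (intro exI[of _ m] exI[of _ s]) simp
  qed
next
  interpret real_distribution std_normal_distribution by (rule real_dist_normal_dist)
  assume "\<exists>m s. \<mu> = distr std_normal_distribution borel (\<lambda>t. m + s * t)"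
  then obtain m s where \<mu>: "\<mu> = distr std_normal_distribution borel (\<lambda>t. m + s * t)" by blast
  show "real_gaussian \<mu>"
  proof (cases "s = 0")
    case True
    then have "\<mu> = return borel m" by (simp add: \<mu> distr_const)
    then show ?thesis by (auto simp: real_gaussian_def)
  next
    case False
    then show ?thesis
      unfolding real_gaussian_def \<mu> std_normal_affine_density[OF False]
      by (intro disjI2 exI[of _ m] exI[of _ "\<bar>s\<bar>"]) simp
  qed
qed

lemma std_normal_affine_uminus:
  "distr std_normal_distribution borel (\<lambda>t. m + (- s) * t) =
   distr std_normal_distribution borel (\<lambda>t. m + s * t)"
  using std_normal_affine_density[of s m] std_normal_affine_density[of "- s" m]
  by (cases "s = 0") auto

lemma char_affine_std_normal:
  "char (distr std_normal_distribution borel (\<lambda>t. m + s * t)) u =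
     iexp (u * m) * complex_of_real (exp (- ((s * u)\<^sup>2) / 2))"
proof -
  have "char (distr std_normal_distribution borel (\<lambda>t. m + s * t)) u =
     (CLINT t|std_normal_distribution. iexp (u * m) * iexp ((s * u) * t))"
    unfolding char_def
    by (subst integral_distr)
      (auto simp: exp_add[symmetric] algebra_simps intro!: Bochner_Integration.integral_cong)
  also have "\<dots> = iexp (u * m) * char std_normal_distribution (s * u)"
    by (simp add: char_def)
  finally show ?thesis by (simp add: char_std_normal_distribution)
qed

text \<open>
  Levy's uniqueness theorem covers the degenerate summands together with the others, because the
  characteristic function of the normal form depends on \<open>s\<close> only through \<open>s\<^sup>2\<close>, for which \<open>0\<close> is allowed.
\<close>

lemma (in prob_space) real_gaussian_add:
  fixes X Y :: "'a \<Rightarrow> real"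
  assumes indep: "indep_var borel X borel Y"
    and "real_gaussian (distr M borel X)" "real_gaussian (distr M borel Y)"
  shows "real_gaussian (distr M borel (\<lambda>w. X w + Y w))"
proof -
  obtain m s where X: "distr M borel X = distr std_normal_distribution borel (\<lambda>t. m + s * t)"
    using assms(2) real_gaussian_iff_affine_std_normal by blast
  obtain m' s' where Y: "distr M borel Y = distr std_normal_distribution borel (\<lambda>t. m' + s' * t)"
    using assms(3) real_gaussian_iff_affine_std_normal by blast
  have [measurable]: "random_variable borel X" "random_variable borel Y"
    using indep by (auto dest: indep_var_rv1 indep_var_rv2)
  define G where "G = distr std_normal_distribution borel (\<lambda>t. (m + m') + sqrt (s\<^sup>2 + s'\<^sup>2) * t)"
  have "char (distr M borel (\<lambda>w. X w + Y w)) u = char G u" for u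
  proof -
    have "exp (- ((sqrt (s\<^sup>2 + s'\<^sup>2) * u)\<^sup>2) / 2) = exp (- ((s * u)\<^sup>2) / 2) * exp (- ((s' * u)\<^sup>2) / 2)"
      by (simp add: power_mult_distrib exp_add[symmetric] field_simps)
    moreover have "iexp (u * (m + m')) = iexp (u * m) * iexp (u * m')"
      by (simp add: exp_add[symmetric] algebra_simps)
    ultimately show ?thesis
      unfolding char_distr_add[OF indep] X Y G_def char_affine_std_normal
      by (simp only: of_real_mult mult_ac)
  qed
  then have "char (distr M borel (\<lambda>w. X w + Y w)) = char G" by blast
  then have "distr M borel (\<lambda>w. X w + Y w) = G"
    by (intro Levy_uniqueness real_distribution_distr)
      (auto simp: G_def intro!: prob_space.real_distribution_distr real_distribution.axioms(1)[OF real_dist_normal_dist])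
  then show ?thesis
    using real_gaussian_iff_affine_std_normal unfolding G_def by blast
qed

lemma real_gaussian_affine:
  assumes "real_gaussian \<mu>"
  shows "real_gaussian (distr \<mu> borel (\<lambda>t. a + b * t))"
proof -
  obtain m s where \<mu>: "\<mu> = distr std_normal_distribution borel (\<lambda>t. m + s * t)"
    using assms real_gaussian_iff_affine_std_normal by blast
  have "distr \<mu> borel (\<lambda>t. a + b * t) = distr std_normal_distribution borel (\<lambda>t. (a + b * m) + (b * s) * t)"
    unfolding \<mu> by (subst distr_distr) (auto simp: o_def algebra_simps)
  then show ?thesis using real_gaussian_iff_affine_std_normal by blast
qed

lemma affine_std_normal_second_moment:
  shows "integrable std_normal_distribution (\<lambda>t. (m + s * t)\<^sup>2)"
    and "(LINT t|std_normal_distribution. (m + s * t)\<^sup>2) = m\<^sup>2 + s\<^sup>2"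
proof -
  interpret real_distribution std_normal_distribution by (rule real_dist_normal_dist)
  have i: "integrable std_normal_distribution (\<lambda>t. t)" "integrable std_normal_distribution (\<lambda>t. t\<^sup>2)"
    using integrable_std_normal_distribution_moment[of 1] integrable_std_normal_distribution_moment[of 2] by simp_all
  have v: "(LINT t|std_normal_distribution. t) = 0" "(LINT t|std_normal_distribution. t\<^sup>2) = 1"
    using integral_std_normal_distribution_moment_odd[of 1] std_normal_distribution_even_moments(1)[of 1] by simp_all
  have eq: "(m + s * t)\<^sup>2 = m\<^sup>2 + ((2 * m * s) * t + s\<^sup>2 * t\<^sup>2)" for t :: real
    by (simp add: power2_eq_square algebra_simps)
  show "integrable std_normal_distribution (\<lambda>t. (m + s * t)\<^sup>2)" unfolding eq using i by simp
  show "(LINT t|std_normal_distribution. (m + s * t)\<^sup>2) = m\<^sup>2 + s\<^sup>2"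
    unfolding eq using i v prob_space by simp
qed

text \<open>
  The density is at most \<open>1 / sqrt (2 * pi) \<le> 1/2\<close> and the interval has length \<open>1\<close>.
\<close>

lemma std_normal_small_interval: "measure std_normal_distribution {-1/2..1/2} \<le> 1/2"
proof -
  define I where "I = {-1/2..1/2::real}"
  have "4 \<le> 2 * pi" using pi_ge_two by simp
  then have "sqrt 4 \<le> sqrt (2 * pi)" by (rule real_sqrt_le_mono)
  then have "1 / sqrt (2 * pi) \<le> 1 / 2" by (intro divide_left_mono) auto
  moreover have "exp (- x\<^sup>2 / 2) \<le> 1" for x :: real by simp
  ultimately have "std_normal_density x \<le> 1/2 * 1" for x
    unfolding std_normal_density_def by (intro mult_mono) auto
  then have le: "ennreal (std_normal_density x) \<le> ennreal (1/2)" for x by (intro ennreal_leI) (metis mult.right_neutral)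
  have "emeasure std_normal_distribution I =
      (\<integral>\<^sup>+x. ennreal (std_normal_density x) * indicator I x \<partial>lborel)"
    by (rule emeasure_density) (auto simp: I_def)
  also have "\<dots> \<le> (\<integral>\<^sup>+x. ennreal (1/2) * indicator I x \<partial>lborel)"
    by (intro nn_integral_mono mult_right_mono le) auto
  also have "\<dots> = ennreal (1/2) * emeasure lborel I"
    by (rule nn_integral_cmult_indicator) (auto simp: I_def)
  also have "\<dots> = ennreal (1/2)" by (simp add: I_def)
  finally show ?thesis unfolding measure_def I_def[symmetric] by (metis enn2real_leI ennreal_leI zero_le_divide_1_iff zero_le_numeral)
qed

text \<open>
  For Gaussian laws, smallness in probability controls the second moment. Let the law be that of
  \<open>m + s t\<close> with \<open>t\<close> standard normal. By symmetry \<open>\<bar>m + s t\<bar> \<le> \<epsilon>\<close> and \<open>\<bar>m - s t\<bar> \<le> \<epsilon>\<close> each fail with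
  probability below \<open>1/4\<close>, and \<open>\<bar>t\<bar> > 1/2\<close> fails with probability at most \<open>1/2\<close>; so some \<open>t\<close> satisfies
  all three, which gives \<open>\<bar>m\<bar> \<le> \<epsilon>\<close> and \<open>\<bar>s\<bar> \<le> 2\<epsilon>\<close>.
\<close>

lemma real_gaussian_second_moment_le:
  assumes gauss: "real_gaussian \<mu>" and big: "measure \<mu> {-\<epsilon>..\<epsilon>} > 3/4"
  shows "(LINT t|\<mu>. t\<^sup>2) \<le> 5 * \<epsilon>\<^sup>2"
proof -
  interpret real_distribution std_normal_distribution by (rule real_dist_normal_dist)
  obtain m s where \<mu>: "\<mu> = distr std_normal_distribution borel (\<lambda>t. m + s * t)"
    using gauss real_gaussian_iff_affine_std_normal by blast
  define A where "A b = {t. m + b * t \<in> {-\<epsilon>..\<epsilon>}}" for b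
  have A[measurable]: "A b \<in> sets borel" for b unfolding A_def by measurable
  have "prob (A s) > 3/4" 
    using big unfolding \<mu> by (subst (asm) measure_distr) (auto simp: A_def vimage_def)
  moreover have "prob (A (- s)) > 3/4" 
    using big unfolding \<mu> std_normal_affine_uminus[symmetric, of m s] 
    by (subst (asm) measure_distr) (auto simp: A_def vimage_def)
  moreover have "prob UNIV \<le> prob (- A s) + prob (- A (- s)) + prob {-1/2..1/2}" 
    if "A s \<inter> A (- s) \<subseteq> {-1/2..1/2}"
  proof -
    have "prob UNIV \<le> prob ((- A s \<union> - A (- s)) \<union> {-1/2..1/2})"
      using that by (intro finite_measure_mono) auto
    also have "\<dots> \<le> prob (- A s \<union> - A (- s)) + prob {-1/2..1/2}"
      by (intro measure_Un_le) auto
    also have "prob (- A s \<union> - A (- s)) \<le> prob (- A s) + prob (- A (- s))"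
      by (intro measure_Un_le) auto
    finally show ?thesis by simp
  qed
  moreover have "prob (- A b) = 1 - prob (A b)" for b
    using prob_compl[of "A b"] A by (simp add: Compl_eq_Diff_UNIV)
  moreover have "prob UNIV = 1" using prob_space by simp
  ultimately have "\<not> A s \<inter> A (- s) \<subseteq> {-1/2..1/2}"
    using std_normal_small_interval by (auto simp del: measure_le_1)
  then obtain t where t: "t \<in> A s" "t \<in> A (- s)" "t \<notin> {-1/2..1/2}" by blast
  have m: "\<bar>m\<bar> \<le> \<epsilon>" and st: "\<bar>s * t\<bar> \<le> \<epsilon>" using t(1,2) by (auto simp: A_def)
  have "\<bar>s\<bar> * (1/2) \<le> \<bar>s\<bar> * \<bar>t\<bar>" using t(3) by (intro mult_left_mono) auto
  then have s: "\<bar>s\<bar> \<le> 2 * \<epsilon>" using st by (simp add: abs_mult)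
  have "m\<^sup>2 \<le> \<epsilon>\<^sup>2" "s\<^sup>2 \<le> (2 * \<epsilon>)\<^sup>2" using m s by (metis power_mono abs_ge_zero power2_abs)+
  then have "m\<^sup>2 + s\<^sup>2 \<le> 5 * \<epsilon>\<^sup>2" by (simp add: power_mult_distrib)
  moreover have "(LINT t|\<mu>. t\<^sup>2) = m\<^sup>2 + s\<^sup>2"
    unfolding \<mu> by (subst integral_distr) (auto simp: affine_std_normal_second_moment)
  ultimately show ?thesis by simp
qed

text \<open>
  The integral of \<open>(f + t g)\<^sup>2\<close> is a polynomial in \<open>t\<close> of degree at most two without negative values.
\<close>

lemma integral_Cauchy_Schwarz:
  fixes f g :: "'a \<Rightarrow> real"
  assumes f: "integrable M (\<lambda>x. (f x)\<^sup>2)" and g: "integrable M (\<lambda>x. (g x)\<^sup>2)"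
    and fg: "integrable M (\<lambda>x. f x * g x)"
  shows "\<bar>LINT x|M. f x * g x\<bar> \<le> sqrt (LINT x|M. (f x)\<^sup>2) * sqrt (LINT x|M. (g x)\<^sup>2)"
proof -
  define F G H where "F = (LINT x|M. (f x)\<^sup>2)" and "G = (LINT x|M. (g x)\<^sup>2)" and "H = (LINT x|M. f x * g x)"
  have pos: "0 \<le> F + (2 * t) * H + t\<^sup>2 * G" for t
  proof -
    have "(f x + t * g x)\<^sup>2 = (f x)\<^sup>2 + ((2 * t) * (f x * g x) + t\<^sup>2 * (g x)\<^sup>2)" for x
      by (simp add: power2_eq_square algebra_simps)
    then have "(LINT x|M. (f x + t * g x)\<^sup>2) = F + ((2 * t) * H + t\<^sup>2 * G)"
      using f g fg by (simp add: F_def G_def H_def)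
    moreover have "0 \<le> (LINT x|M. (f x + t * g x)\<^sup>2)" by simp
    ultimately show ?thesis by simp
  qed
  have "H\<^sup>2 \<le> F * G"
  proof (cases "G = 0")
    case True
    have "H = 0"
    proof (rule ccontr)
      assume "H \<noteq> 0"
      \<comment> \<open>With \<open>G = 0\<close> the polynomial is affine in \<open>t\<close>; at this \<open>t\<close> it would equal \<open>-1\<close>.\<close>
      then show False using pos[of "- (F + 1) / (2 * H)"] True by (simp add: field_simps)
    qed
    then show ?thesis using True by simp
  next
    case False
    have "G \<ge> 0" by (simp add: G_def)
    then have "G > 0" using False by simp
    then show ?thesis using pos[of "- H / G"] by (simp add: power2_eq_square field_simps)
  qed
  then have "sqrt (H\<^sup>2) \<le> sqrt (F * G)" by (rule real_sqrt_le_mono)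
  then show ?thesis by (simp add: F_def G_def H_def real_sqrt_mult)
qed

section \<open>Moments and continuity of Gaussian measures\<close>

lemma integrable_vec:
  fixes f :: "'a \<Rightarrow> ('b::euclidean_space) ^ 'n"
  assumes "\<And>i. integrable M (\<lambda>x. f x $ i)"
  shows "integrable M f"
proof -
  have "bounded_linear (axis i :: 'b \<Rightarrow> 'b ^ 'n)" for i
    by (auto simp: linear_conv_bounded_linear[symmetric] axis_def vec_eq_iff intro!: linearI)
  then have "integrable M (\<lambda>x. \<Sum>i\<in>UNIV. axis i (f x $ i))"
    by (intro Bochner_Integration.integrable_sum integrable_bounded_linear[OF _ assms])
  moreover have "(\<Sum>i\<in>UNIV. axis i (v $ i)) = v" for v :: "'b ^ 'n"
    by (simp add: vec_eq_iff axis_def if_distrib[of "\<lambda>z. z $ _"] sum.delta cong: if_cong)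
  ultimately show ?thesis by simp
qed

lemma bounded_linear_apply_bcontfun:
  "bounded_linear (\<lambda>f :: 'a::topological_space \<Rightarrow>\<^sub>C 'b::real_normed_vector. apply_bcontfun f x)"
  by (rule bounded_linear_intro[where K=1]) (auto simp: norm_bounded)

lemma bounded_linear_eval:
  "bounded_linear (\<lambda>f :: 'a::topological_space \<Rightarrow>\<^sub>C (real ^ 'd). apply_bcontfun f x $ i)"
  using bounded_linear_compose[OF bounded_linear_vec_nth bounded_linear_apply_bcontfun] .

text \<open>
  The elements of \<^const>\<open>gaussian_measures\<close> as a locale, which makes the theory of \<^locale>\<open>prob_space\<close>
  available for them.
\<close>

locale gaussian_measure = prob_space \<nu>
  for \<nu> :: "('a::metric_space \<Rightarrow>\<^sub>C (real ^ 'd)) measure" +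
  assumes sets_eq [simp, measurable_cong]: "sets \<nu> = sets borel"
    and functional_gaussian: "\<And>L :: ('a \<Rightarrow>\<^sub>C (real ^ 'd)) \<Rightarrow> real.
      bounded_linear L \<Longrightarrow> real_gaussian (distr \<nu> borel L)"

lemma gaussian_measures_iff: "\<nu> \<in> gaussian_measures \<longleftrightarrow> gaussian_measure \<nu>"
  by (auto simp: gaussian_measures_def gaussian_measure_def gaussian_measure_axioms_def)

context gaussian_measure
begin

lemma space_eq [simp]: "space \<nu> = UNIV"
  using sets_eq_imp_space_eq[OF sets_eq] by simp

lemma measurable_bounded_linear:
  fixes L :: "_ \<Rightarrow> 'c::real_normed_vector"
  assumes "bounded_linear L"
  shows "L \<in> borel_measurable \<nu>"
proof -
  have "L \<in> borel_measurable borel"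
    using assms by (intro borel_measurable_continuous_onI linear_continuous_on)
  then show ?thesis by simp
qed

text \<open>
  Square integrability of \<open>L\<close> depends only on its law, so it can be checked on the normal form.
\<close>

lemma integrable_functional_square:
  fixes L :: "_ \<Rightarrow> real"
  assumes L: "bounded_linear L"
  shows "integrable \<nu> (\<lambda>f. (L f)\<^sup>2)"
proof -
  obtain m s where ms: "distr \<nu> borel L = distr std_normal_distribution borel (\<lambda>t. m + s * t)"
    using functional_gaussian[OF L] real_gaussian_iff_affine_std_normal by blast
  have "integrable (distr std_normal_distribution borel (\<lambda>t. m + s * t)) (\<lambda>t. t\<^sup>2)"
    by (subst integrable_distr_eq) (auto simp: affine_std_normal_second_moment)
  then show ?thesis
    unfolding ms[symmetric] using measurable_bounded_linear[OF L] by (simp add: integrable_distr_eq)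
qed

lemma integrable_functional:
  fixes L :: "_ \<Rightarrow> real"
  assumes L: "bounded_linear L"
  shows "integrable \<nu> L"
  using square_integrable_imp_integrable[OF measurable_bounded_linear[OF L] integrable_functional_square[OF L]] .

lemma integrable_functional_mult:
  fixes L L' :: "_ \<Rightarrow> real"
  assumes L: "bounded_linear L" and L': "bounded_linear L'"
  shows "integrable \<nu> (\<lambda>f. L f * L' f)"
proof -
  have "integrable \<nu> (\<lambda>f. ((L f + L' f)\<^sup>2 - (L f)\<^sup>2 - (L' f)\<^sup>2) / 2)"
    using integrable_functional_square[OF bounded_linear_add[OF L L']]
      integrable_functional_square[OF L] integrable_functional_square[OF L'] by simp
  then show ?thesis by (simp add: power2_sum)
qed

lemma functional_Cauchy_Schwarz:
  fixes L L' :: "_ \<Rightarrow> real"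
  assumes L: "bounded_linear L" and L': "bounded_linear L'"
  shows "\<bar>LINT f|\<nu>. L f * L' f\<bar> \<le> sqrt (LINT f|\<nu>. (L f)\<^sup>2) * sqrt (LINT f|\<nu>. (L' f)\<^sup>2)"
  by (intro integral_Cauchy_Schwarz integrable_functional_square integrable_functional_mult L L')

lemma abs_integral_functional_le:
  fixes L :: "_ \<Rightarrow> real"
  assumes L: "bounded_linear L"
  shows "\<bar>LINT f|\<nu>. L f\<bar> \<le> sqrt (LINT f|\<nu>. (L f)\<^sup>2)"
  using integral_Cauchy_Schwarz[of \<nu> L "\<lambda>_. 1"] integrable_functional_square[OF L]
    integrable_functional[OF L] prob_space by simp

text \<open>
  Pointwise convergence by itself only gives convergence in probability in general. For Gaussian variables the
  law of \<open>D n\<close> then has a small second moment as well.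
\<close>

lemma pointwise_imp_L2_convergence:
  fixes D :: "nat \<Rightarrow> _ \<Rightarrow> real"
  assumes D: "\<And>n. bounded_linear (D n)" and lim: "\<And>f. (\<lambda>n. D n f) \<longlonglongrightarrow> 0"
  shows "(\<lambda>n. LINT f|\<nu>. (D n f)\<^sup>2) \<longlonglongrightarrow> 0"
proof (rule tendstoI)
  fix \<eta> :: real assume \<eta>: "\<eta> > 0"
  \<comment> \<open>Chosen so that \<open>5 \<epsilon>\<^sup>2 = \<eta> / 2\<close>.\<close>
  define \<epsilon> where "\<epsilon> = sqrt (\<eta> / 10)"
  have \<epsilon>: "\<epsilon> > 0" "5 * \<epsilon>\<^sup>2 < \<eta>" using \<eta> by (auto simp: \<epsilon>_def)
  note [measurable] = measurable_bounded_linear[OF D]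
  define E where "E n = {f. D n f \<in> {-\<epsilon>..\<epsilon>}}" for n
  have [measurable]: "E n \<in> sets \<nu>" for n
  proof -
    have "{f \<in> space \<nu>. D n f \<in> {-\<epsilon>..\<epsilon>}} \<in> sets \<nu>" by measurable
    then show ?thesis by (simp add: E_def)
  qed
  have "(\<lambda>n. LINT f|\<nu>. indicator (E n) f) \<longlonglongrightarrow> (LINT f|\<nu>. (1::real))"
  proof (rule integral_dominated_convergence[where w="\<lambda>_. 1"])
    have "(\<lambda>n. indicator (E n) f :: real) \<longlonglongrightarrow> 1" for f
    proof (rule tendsto_eventually)
      have "\<forall>\<^sub>F n in sequentially. \<bar>D n f\<bar> < \<epsilon>"
        using tendstoD[OF lim \<epsilon>(1), of f] by simp
      then show "\<forall>\<^sub>F n in sequentially. indicator (E n) f = (1::real)"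
        by eventually_elim (auto simp: E_def indicator_def)
    qed
    then show "AE f in \<nu>. (\<lambda>n. indicator (E n) f :: real) \<longlonglongrightarrow> 1" by simp
  qed auto
  then have "(\<lambda>n. prob (E n)) \<longlonglongrightarrow> 1" using prob_space by simp
  then have "\<forall>\<^sub>F n in sequentially. prob (E n) > 3/4"
    by (rule order_tendstoD) simp
  then show "\<forall>\<^sub>F n in sequentially. dist (LINT f|\<nu>. (D n f)\<^sup>2) 0 < \<eta>"
  proof eventually_elim
    fix n assume n: "prob (E n) > 3/4"
    have "measure (distr \<nu> borel (D n)) {-\<epsilon>..\<epsilon>} = prob (E n)"
      by (subst measure_distr) (auto simp: E_def vimage_def)
    then have "(LINT t|distr \<nu> borel (D n). t\<^sup>2) \<le> 5 * \<epsilon>\<^sup>2"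
      using n by (intro real_gaussian_second_moment_le functional_gaussian D) simp
    then have "(LINT f|\<nu>. (D n f)\<^sup>2) \<le> 5 * \<epsilon>\<^sup>2" by (subst (asm) integral_distr) auto
    then show "dist (LINT f|\<nu>. (D n f)\<^sup>2) 0 < \<eta>" using \<epsilon> by simp
  qed
qed

text \<open>
  With \<open>D = L n - L0\<close> and \<open>D' = L' n - L0'\<close> the error is the expectation of \<open>D D' + D L0' + L0 D'\<close>,
  and each term is small by the Cauchy-Schwarz inequality.
\<close>

lemma tendsto_integral_functional_mult:
  fixes L L' :: "nat \<Rightarrow> _ \<Rightarrow> real"
  assumes L: "\<And>n. bounded_linear (L n)" "bounded_linear L0" and limL: "\<And>f. (\<lambda>n. L n f) \<longlonglongrightarrow> L0 f"
    and L': "\<And>n. bounded_linear (L' n)" "bounded_linear L0'" and limL': "\<And>f. (\<lambda>n. L' n f) \<longlonglongrightarrow> L0' f"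
  shows "(\<lambda>n. LINT f|\<nu>. L n f * L' n f) \<longlonglongrightarrow> (LINT f|\<nu>. L0 f * L0' f)"
proof -
  define D D' where "D n f = L n f - L0 f" and "D' n f = L' n f - L0' f" for n f
  have D: "bounded_linear (D n)" "bounded_linear (D' n)" for n
    using L L' bounded_linear_sub by (auto simp: D_def[abs_def] D'_def[abs_def])
  have lim0: "(\<lambda>n. D n f) \<longlonglongrightarrow> 0" "(\<lambda>n. D' n f) \<longlonglongrightarrow> 0" for f
    using limL limL' by (auto simp: D_def D'_def LIM_zero)
  define q where "q K = sqrt (LINT f|\<nu>. (K f)\<^sup>2)" for K :: "_ \<Rightarrow> real"
  have "(\<lambda>n. q (D n)) \<longlonglongrightarrow> sqrt 0" "(\<lambda>n. q (D' n)) \<longlonglongrightarrow> sqrt 0"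
    unfolding q_def by (intro tendsto_real_sqrt pointwise_imp_L2_convergence D lim0)+
  then have q0: "(\<lambda>n. q (D n)) \<longlonglongrightarrow> 0" "(\<lambda>n. q (D' n)) \<longlonglongrightarrow> 0" by simp_all
  have "(\<lambda>n. q (D n) * q (D' n) + (q (D n) * q L0' + q L0 * q (D' n))) \<longlonglongrightarrow> 0 * 0 + (0 * q L0' + q L0 * 0)"
    by (intro tendsto_intros q0)
  then have lim: "(\<lambda>n. q (D n) * q (D' n) + (q (D n) * q L0' + q L0 * q (D' n))) \<longlonglongrightarrow> 0" by simp
  have "(\<lambda>n. (LINT f|\<nu>. L n f * L' n f) - (LINT f|\<nu>. L0 f * L0' f)) \<longlonglongrightarrow> 0"
  proof (rule Lim_null_comparison[OF always_eventually[OF allI] lim])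
    fix n
    have "L n f * L' n f = L0 f * L0' f + (D n f * D' n f + (D n f * L0' f + L0 f * D' n f))" for f
      by (simp add: D_def D'_def algebra_simps)
    then have "(LINT f|\<nu>. L n f * L' n f) - (LINT f|\<nu>. L0 f * L0' f) =
       (LINT f|\<nu>. D n f * D' n f) + ((LINT f|\<nu>. D n f * L0' f) + (LINT f|\<nu>. L0 f * D' n f))"
      by (simp add: integrable_functional_mult D L L')
    then show "norm ((LINT f|\<nu>. L n f * L' n f) - (LINT f|\<nu>. L0 f * L0' f)) \<le>
        q (D n) * q (D' n) + (q (D n) * q L0' + q L0 * q (D' n))"
      using functional_Cauchy_Schwarz[OF D, of n n] functional_Cauchy_Schwarz[OF D(1) L'(2), of n]
        functional_Cauchy_Schwarz[OF L(2) D(2), of n] by (simp add: q_def)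
  qed
  then show ?thesis by (rule LIM_zero_cancel)
qed

lemma tendsto_integral_functional:
  fixes L :: "nat \<Rightarrow> _ \<Rightarrow> real"
  assumes L: "\<And>n. bounded_linear (L n)" "bounded_linear L0" and lim: "\<And>f. (\<lambda>n. L n f) \<longlonglongrightarrow> L0 f"
  shows "(\<lambda>n. LINT f|\<nu>. L n f) \<longlonglongrightarrow> (LINT f|\<nu>. L0 f)"
proof -
  have D: "bounded_linear (\<lambda>f. L n f - L0 f)" for n by (intro bounded_linear_sub L)
  have "(\<lambda>n. sqrt (LINT f|\<nu>. (L n f - L0 f)\<^sup>2)) \<longlonglongrightarrow> sqrt 0"
    using lim by (intro tendsto_real_sqrt pointwise_imp_L2_convergence D) (simp add: LIM_zero)
  then have "(\<lambda>n. sqrt (LINT f|\<nu>. (L n f - L0 f)\<^sup>2)) \<longlonglongrightarrow> 0" by simp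
  then have "(\<lambda>n. (LINT f|\<nu>. L n f) - (LINT f|\<nu>. L0 f)) \<longlonglongrightarrow> 0"
    by (rule Lim_null_comparison[rotated])
      (use abs_integral_functional_le[OF D] in \<open>simp add: integrable_functional L\<close>)
  then show ?thesis by (rule LIM_zero_cancel)
qed

lemma integrable_eval: "integrable \<nu> (\<lambda>f. apply_bcontfun f x)"
  by (intro integrable_vec integrable_functional bounded_linear_eval)

lemma mean_fun_nth: "mean_fun \<nu> x $ i = (LINT f|\<nu>. apply_bcontfun f x $ i)"
  unfolding mean_fun_def by (simp add: integral_bounded_linear[OF bounded_linear_vec_nth integrable_eval])

text \<open>
  Expands the centred product into terms whose integrability is known one by one.
\<close>

lemma centred_mult_eq:
  "(apply_bcontfun f x - mean_fun \<nu> x) $ i * (apply_bcontfun f y - mean_fun \<nu> y) $ j =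
   apply_bcontfun f x $ i * apply_bcontfun f y $ j -
   (mean_fun \<nu> y $ j * apply_bcontfun f x $ i + (mean_fun \<nu> x $ i * apply_bcontfun f y $ j
     - mean_fun \<nu> x $ i * mean_fun \<nu> y $ j))"
  by (simp add: algebra_simps)

lemma integrable_outer_centred:
  "integrable \<nu> (\<lambda>f. outer (apply_bcontfun f x - mean_fun \<nu> x) (apply_bcontfun f y - mean_fun \<nu> y))"
proof (intro integrable_vec)
  fix i j
  have "integrable \<nu> (\<lambda>f. (apply_bcontfun f x - mean_fun \<nu> x) $ i * (apply_bcontfun f y - mean_fun \<nu> y) $ j)"
    unfolding centred_mult_eq
    by (intro Bochner_Integration.integrable_diff Bochner_Integration.integrable_add integrable_mult_right
        integrable_functional_mult integrable_functional bounded_linear_eval integrable_const)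
  then show "integrable \<nu> (\<lambda>f. outer (apply_bcontfun f x - mean_fun \<nu> x) (apply_bcontfun f y - mean_fun \<nu> y) $ i $ j)"
    by (simp add: outer_def)
qed

lemma cov_fun_nth:
  "cov_fun \<nu> x y $ i $ j =
    (LINT f|\<nu>. apply_bcontfun f x $ i * apply_bcontfun f y $ j) - mean_fun \<nu> x $ i * mean_fun \<nu> y $ j"
proof -
  have "cov_fun \<nu> x y $ i $ j =
     (LINT f|\<nu>. (apply_bcontfun f x - mean_fun \<nu> x) $ i * (apply_bcontfun f y - mean_fun \<nu> y) $ j)"
    unfolding cov_fun_def
    using integral_bounded_linear[OF bounded_linear_compose[OF bounded_linear_vec_nth[of j] bounded_linear_vec_nth[of i]]
        integrable_outer_centred[of x y]]
    by (simp add: outer_def)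
  also have "\<dots> = (LINT f|\<nu>. apply_bcontfun f x $ i * apply_bcontfun f y $ j) - mean_fun \<nu> x $ i * mean_fun \<nu> y $ j"
    unfolding centred_mult_eq using prob_space
    by (simp add: integrable_functional_mult integrable_functional bounded_linear_eval mean_fun_nth)
  finally show ?thesis .
qed

lemma transpose_cov_fun: "transpose (cov_fun \<nu> x y) = cov_fun \<nu> y x"
  by (simp add: vec_eq_iff transpose_def cov_fun_nth mult.commute)

lemma tendsto_eval:
  assumes "s \<longlonglongrightarrow> x" shows "(\<lambda>n. apply_bcontfun f (s n) $ i) \<longlonglongrightarrow> apply_bcontfun f x $ i"
  using continuous_on_tendsto_compose[OF continuous_on_apply_bcontfun assms, of UNIV f] tendsto_vec_nth by auto

text \<open>
  Evaluation at \<open>s n\<close> converges to evaluation at \<open>x\<close> at every continuous function, although in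
  general not in the operator norm; pointwise convergence of functionals is what the moment limits require.
\<close>

lemma continuous_mean_fun: "continuous_on UNIV (mean_fun \<nu>)"
proof -
  have "(\<lambda>n. mean_fun \<nu> (s n)) \<longlonglongrightarrow> mean_fun \<nu> x" if "s \<longlonglongrightarrow> x" for s x
    by (rule vec_tendstoI, unfold mean_fun_nth)
      (intro tendsto_integral_functional bounded_linear_eval tendsto_eval that)
  then show ?thesis by (simp add: continuous_on_sequentially o_def)
qed

lemma continuous_cov_fun: "continuous_on UNIV (\<lambda>p. cov_fun \<nu> (fst p) (snd p))"
proof -
  have "(\<lambda>n. cov_fun \<nu> (fst (s n)) (snd (s n))) \<longlonglongrightarrow> cov_fun \<nu> (fst p) (snd p)" if s: "s \<longlonglongrightarrow> p" for s p
  proof (intro vec_tendstoI, unfold cov_fun_nth)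
    fix i j
    have s': "(\<lambda>n. fst (s n)) \<longlonglongrightarrow> fst p" "(\<lambda>n. snd (s n)) \<longlonglongrightarrow> snd p"
      using s by (auto intro: tendsto_fst tendsto_snd)
    have m: "(\<lambda>n. mean_fun \<nu> (t n) $ k) \<longlonglongrightarrow> mean_fun \<nu> q $ k" if "t \<longlonglongrightarrow> q" for t q k
      using continuous_on_tendsto_compose[OF continuous_mean_fun that] tendsto_vec_nth by auto
    show "(\<lambda>n. (LINT f|\<nu>. apply_bcontfun f (fst (s n)) $ i * apply_bcontfun f (snd (s n)) $ j) -
          mean_fun \<nu> (fst (s n)) $ i * mean_fun \<nu> (snd (s n)) $ j)
        \<longlonglongrightarrow> (LINT f|\<nu>. apply_bcontfun f (fst p) $ i * apply_bcontfun f (snd p) $ j) -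
          mean_fun \<nu> (fst p) $ i * mean_fun \<nu> (snd p) $ j"
      by (intro tendsto_diff tendsto_mult m s' tendsto_integral_functional_mult bounded_linear_eval tendsto_eval)
  qed
  then show ?thesis by (simp add: continuous_on_sequentially o_def)
qed

end

section \<open>Affine images\<close>

context gaussian_measure
begin

lemma
  fixes \<Phi> :: "('a \<Rightarrow>\<^sub>C (real ^ 'd)) \<Rightarrow> ('a \<Rightarrow>\<^sub>C (real ^ 'd))" and h
  assumes \<Phi>: "bounded_linear \<Phi>"
  defines "\<mu> \<equiv> distr \<nu> borel (\<lambda>f. \<Phi> f + h)"
  shows gaussian_affine_image: "gaussian_measure \<mu>"
    and mean_affine_image: "mean_fun \<mu> y = (LINT f|\<nu>. apply_bcontfun (\<Phi> f) y) + apply_bcontfun h y"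
    and cov_affine_image: "cov_fun \<mu> y y' = (LINT f|\<nu>. outer
      (apply_bcontfun (\<Phi> f) y - (LINT f|\<nu>. apply_bcontfun (\<Phi> f) y))
      (apply_bcontfun (\<Phi> f) y' - (LINT f|\<nu>. apply_bcontfun (\<Phi> f) y')))"
proof -
  have "continuous_on UNIV (\<lambda>f. \<Phi> f + h)"
    by (intro continuous_intros linear_continuous_on \<Phi>)
  then have "(\<lambda>f. \<Phi> f + h) \<in> borel_measurable borel"
    by (rule borel_measurable_continuous_onI)
  then have T[measurable]: "(\<lambda>f. \<Phi> f + h) \<in> borel_measurable \<nu>" by simp
  show "gaussian_measure \<mu>"
  proof (unfold gaussian_measure_def gaussian_measure_axioms_def, intro conjI allI impI)
    show "sets \<mu> = sets borel" by (simp add: \<mu>_def)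
    show "prob_space \<mu>" unfolding \<mu>_def by (rule prob_space_distr[OF T])
  next
    fix L :: "('a \<Rightarrow>\<^sub>C (real ^ 'd)) \<Rightarrow> real" assume L: "bounded_linear L"
    then have Lm: "L \<in> borel_measurable borel"
      by (intro borel_measurable_continuous_onI linear_continuous_on)
    have L\<Phi>: "bounded_linear (\<lambda>f. L (\<Phi> f))" by (intro bounded_linear_compose[OF L] \<Phi>)
    note [measurable] = measurable_bounded_linear[OF L\<Phi>]
    have "distr \<mu> borel L = distr \<nu> borel (\<lambda>f. L h + 1 * L (\<Phi> f))"
      unfolding \<mu>_def using L
      by (subst distr_distr[OF Lm T]) (simp add: o_def linear_simps add.commute)
    also have "\<dots> = distr (distr \<nu> borel (\<lambda>f. L (\<Phi> f))) borel (\<lambda>t. L h + 1 * t)"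
      by (subst distr_distr) (auto simp: o_def)
    finally show "real_gaussian (distr \<mu> borel L)"
      by (simp only: real_gaussian_affine[OF functional_gaussian[OF L\<Phi>]])
  qed
  have ev: "(\<lambda>f :: 'a \<Rightarrow>\<^sub>C (real ^ 'd). apply_bcontfun f x) \<in> borel_measurable borel" for x :: 'a
    by (intro borel_measurable_continuous_onI linear_continuous_on bounded_linear_apply_bcontfun)
  have int: "integrable \<nu> (\<lambda>f. apply_bcontfun (\<Phi> f) y)" for y
    by (intro integrable_vec integrable_functional bounded_linear_compose[OF bounded_linear_eval \<Phi>])
  show mean: "mean_fun \<mu> y = (LINT f|\<nu>. apply_bcontfun (\<Phi> f) y) + apply_bcontfun h y" for y
    unfolding mean_fun_def \<mu>_def
    using prob_space by (subst integral_distr[OF T ev]) (simp add: int)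
  have [measurable]: "(\<lambda>f. outer (apply_bcontfun f y - a) (apply_bcontfun f y' - b)) \<in> borel_measurable borel" for a b
    by (intro borel_measurable_continuous_onI bounded_bilinear.continuous_on[OF bounded_bilinear_outer]
        continuous_intros linear_continuous_on bounded_linear_apply_bcontfun)
  show "cov_fun \<mu> y y' = (LINT f|\<nu>. outer
      (apply_bcontfun (\<Phi> f) y - (LINT f|\<nu>. apply_bcontfun (\<Phi> f) y))
      (apply_bcontfun (\<Phi> f) y' - (LINT f|\<nu>. apply_bcontfun (\<Phi> f) y')))"
    unfolding cov_fun_def mean
    by (subst \<mu>_def, subst integral_distr[OF T]) simp_all
qed

end

lemma outer_matrix_vector_mult:
  "outer (A *v u) (B *v v) = A ** outer u v ** transpose B"
  by (simp add: outer_def matrix_vector_mult_def matrix_matrix_mult_def transpose_def vec_eq_iff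
      sum_distrib_left sum_distrib_right mult_ac)

lemma outer_sum_columns:
  fixes A :: "real ^ 'n ^ 'm" and B :: "real ^ 'n ^ 'k"
  shows "(\<Sum>j\<in>UNIV. outer (column j A) (column j B)) = A ** transpose B"
  by (simp add: outer_def column_def matrix_matrix_mult_def transpose_def vec_eq_iff)

lemma matrix_vector_mult_sum_columns:
  fixes A :: "real ^ 'n ^ 'm"
  shows "A *v v = (\<Sum>i\<in>UNIV. v $ i *\<^sub>R column i A)"
  by (simp add: column_def matrix_vector_mult_def vec_eq_iff mult.commute)

lemma apply_bcontfun_sum: "apply_bcontfun (\<Sum>i\<in>I. F i) y = (\<Sum>i\<in>I. apply_bcontfun (F i) y)"
  by (induction I rule: infinite_finite_induct) auto

context gaussian_measure
begin

text \<open>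
  The law of \<open>\<xi> + h - G \<xi>(x)\<close> for \<open>\<xi> \<sim> \<nu>\<close>. The functions \<open>g i\<close> are the columns of \<open>G\<close>, so that
  \<open>G \<xi>(x)\<close> is a linear combination of fixed continuous functions and the map is visibly bounded and
  linear in \<open>\<xi>\<close>.
\<close>

lemma gaussian_subtract_evaluation:
  fixes g :: "'d \<Rightarrow> ('a \<Rightarrow>\<^sub>C (real ^ 'd))" and h :: "'a \<Rightarrow>\<^sub>C (real ^ 'd)"
    and G :: "'a \<Rightarrow> real ^ 'd ^ 'd" and x :: 'a
  assumes g: "\<And>i y. apply_bcontfun (g i) y = column i (G y)"
  obtains \<mu> where "gaussian_measure \<mu>"
    and "mean_fun \<mu> = (\<lambda>y. mean_fun \<nu> y - G y *v mean_fun \<nu> x + apply_bcontfun h y)"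
    and "cov_fun \<mu> = (\<lambda>y y'. cov_fun \<nu> y y' - G y ** cov_fun \<nu> x y'
      - cov_fun \<nu> y x ** transpose (G y') + G y ** cov_fun \<nu> x x ** transpose (G y'))"
proof -
  define \<Phi> where "\<Phi> f = f - (\<Sum>i\<in>UNIV. apply_bcontfun f x $ i *\<^sub>R g i)" for f
  have \<Phi>: "bounded_linear \<Phi>"
    unfolding \<Phi>_def[abs_def]
    by (intro bounded_linear_sub bounded_linear_ident bounded_linear_sum
        bounded_linear_compose[OF bounded_linear_scaleR_left bounded_linear_eval])
  have \<Phi>_apply: "apply_bcontfun (\<Phi> f) y = apply_bcontfun f y - G y *v apply_bcontfun f x" for f y
    by (simp add: \<Phi>_def apply_bcontfun_sum g matrix_vector_mult_sum_columns)
  have m: "(LINT f|\<nu>. apply_bcontfun (\<Phi> f) y) = mean_fun \<nu> y - G y *v mean_fun \<nu> x" for y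
    unfolding \<Phi>_apply mean_fun_def
    by (subst Bochner_Integration.integral_diff)
      (auto intro: integrable_eval integrable_bounded_linear[OF matrix_vector_mul_bounded_linear]
        simp: integral_bounded_linear[OF matrix_vector_mul_bounded_linear integrable_eval])
  note L = bounded_bilinear.bounded_linear_left[OF bounded_bilinear_matrix_matrix_mult]
  note R = bounded_bilinear.bounded_linear_right[OF bounded_bilinear_matrix_matrix_mult]
  define c where "c f y = apply_bcontfun f y - mean_fun \<nu> y" for f y
  have I: "integrable \<nu> (\<lambda>f. outer (c f y) (c f y'))" and C: "(LINT f|\<nu>. outer (c f y) (c f y')) = cov_fun \<nu> y y'" for y y'
    using integrable_outer_centred by (auto simp: c_def cov_fun_def)
  have GI: "integrable \<nu> (\<lambda>f. A ** outer (c f y) (c f y'))"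
    and GC: "(LINT f|\<nu>. A ** outer (c f y) (c f y')) = A ** cov_fun \<nu> y y'" for A :: "real ^ 'd ^ 'd" and y y'
    using integrable_bounded_linear[OF R I] integral_bounded_linear[OF R I] C by auto
  have IG: "integrable \<nu> (\<lambda>f. outer (c f y) (c f y') ** A)"
    and CG: "(LINT f|\<nu>. outer (c f y) (c f y') ** A) = cov_fun \<nu> y y' ** A" for A :: "real ^ 'd ^ 'd" and y y'
    using integrable_bounded_linear[OF L I] integral_bounded_linear[OF L I] C by auto
  have GIG: "integrable \<nu> (\<lambda>f. B ** outer (c f y) (c f y') ** A)"
    and GCG: "(LINT f|\<nu>. B ** outer (c f y) (c f y') ** A) = B ** cov_fun \<nu> y y' ** A" for A B :: "real ^ 'd ^ 'd" and y y'
    using integrable_bounded_linear[OF L GI] integral_bounded_linear[OF L GI] GC by auto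
  have "outer (c f y - G y *v c f x) (c f y' - G y' *v c f x) =
      outer (c f y) (c f y') - G y ** outer (c f x) (c f y') - outer (c f y) (c f x) ** transpose (G y')
      + G y ** outer (c f x) (c f x) ** transpose (G y')" for f y y'
    using outer_matrix_vector_mult[of "G y" "c f x" "mat 1" "c f y'"]
      outer_matrix_vector_mult[of "mat 1" "c f y" "G y'" "c f x"]
    by (simp add: bounded_bilinear.diff_left[OF bounded_bilinear_outer]
        bounded_bilinear.diff_right[OF bounded_bilinear_outer] outer_matrix_vector_mult transpose_mat)
  moreover have "apply_bcontfun (\<Phi> f) y - (mean_fun \<nu> y - G y *v mean_fun \<nu> x) = c f y - G y *v c f x" for f y
    by (simp add: \<Phi>_apply c_def matrix_vector_mult_diff_distrib)
  ultimately have cov: "cov_fun (distr \<nu> borel (\<lambda>f. \<Phi> f + h)) y y' = cov_fun \<nu> y y' - G y ** cov_fun \<nu> x y'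
      - cov_fun \<nu> y x ** transpose (G y') + G y ** cov_fun \<nu> x x ** transpose (G y')" for y y'
    unfolding cov_affine_image[OF \<Phi>] m
    by (simp add: I C GI GC IG CG GIG GCG)
  show thesis
    by (rule that[OF gaussian_affine_image[OF \<Phi>, of h]]) (intro ext mean_affine_image[OF \<Phi>, unfolded m] cov)+
qed

end

section \<open>Independent noise\<close>

text \<open>
  The product of the Borel algebras contains the open sets as soon as one factor is second countable:
  for a basic open \<open>B\<close> of that factor let \<open>U B\<close> be the largest open set with \<open>U B \<times> B \<subseteq> W\<close>, and \<open>W\<close> is
  the union of these countably many rectangles. It makes \<open>(f, u) \<mapsto> f + u g\<close> measurable
  on the product of the space of continuous functions with the real line.
\<close>

lemma open_in_sets_pair_borel:
  fixes W :: "('s::topological_space \<times> 't::second_countable_topology) set"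
  assumes W: "open W"
  shows "W \<in> sets (borel \<Otimes>\<^sub>M borel)"
proof -
  obtain \<B> :: "'t set set" where \<B>: "countable \<B>" "topological_basis \<B>"
    using ex_countable_basis by blast
  define U where "U B = \<Union>{A. open A \<and> A \<times> B \<subseteq> W}" for B
  have "W = (\<Union>B\<in>\<B>. U B \<times> B)"
  proof (intro set_eqI iffI)
    fix p assume "p \<in> W"
    then obtain A B where AB: "open A" "open B" "p \<in> A \<times> B" "A \<times> B \<subseteq> W"
      using W open_prod_elim by metis
    then have "snd p \<in> B" by auto
    then obtain B' where B': "B' \<in> \<B>" "snd p \<in> B'" "B' \<subseteq> B"
      by (rule topological_basisE[OF \<B>(2) AB(2)])
    have "A \<times> B' \<subseteq> W" using AB(4) B'(3) by blast
    then have "A \<subseteq> U B'" using AB(1) by (auto simp: U_def)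
    then have "p \<in> U B' \<times> B'" using AB(3) B'(2) by (auto simp: mem_Times_iff)
    then show "p \<in> (\<Union>B\<in>\<B>. U B \<times> B)" using B'(1) by blast
  qed (auto simp: U_def)
  also have "\<dots> \<in> sets (borel \<Otimes>\<^sub>M borel)"
  proof (rule sets.countable_UN'[OF \<B>(1)], rule image_subsetI)
    fix B assume "B \<in> \<B>"
    then have "open B" by (rule topological_basis_open[OF \<B>(2)])
    moreover have "open (U B)" by (auto simp: U_def)
    ultimately show "U B \<times> B \<in> sets (borel \<Otimes>\<^sub>M borel)" by (intro pair_measureI) auto
  qed
  finally show ?thesis .
qed

lemma borel_measurable_continuous_pair:
  fixes F :: "'s::topological_space \<times> 't::second_countable_topology \<Rightarrow> 'u::topological_space"
  assumes "continuous_on UNIV F"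
  shows "F \<in> borel_measurable (borel \<Otimes>\<^sub>M borel)"
proof (rule borel_measurableI)
  fix S :: "'u set" assume "open S"
  then have "open (F -` S)" using assms by (simp add: continuous_on_open_vimage)
  then show "F -` S \<inter> space (borel \<Otimes>\<^sub>M borel) \<in> sets (borel \<Otimes>\<^sub>M borel)"
    using open_in_sets_pair_borel by (simp add: space_pair_measure)
qed

context pair_prob_space
begin

lemma distr_fst: "distr (M1 \<Otimes>\<^sub>M M2) M1 fst = M1"
  by (rule M2.distr_pair_fst)

lemma distr_snd: "distr (M1 \<Otimes>\<^sub>M M2) M2 snd = M2"
proof -
  have "distr (M1 \<Otimes>\<^sub>M M2) M2 snd = distr (M2 \<Otimes>\<^sub>M M1) M2 (snd \<circ> (\<lambda>(x, y). (y, x)))"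
    by (subst distr_pair_swap, subst distr_distr) auto
  also have "snd \<circ> (\<lambda>(x, y). (y, x)) = (fst :: 'b \<times> 'a \<Rightarrow> 'b)" by auto
  finally show ?thesis using M1.distr_pair_fst by simp
qed

lemma indep_var_functions_fst_snd:
  fixes a :: "'a \<Rightarrow> 'c::topological_space" and b :: "'b \<Rightarrow> 'c"
  assumes a[measurable]: "a \<in> borel_measurable M1" and b[measurable]: "b \<in> borel_measurable M2"
  shows "P.indep_var borel (\<lambda>p. a (fst p)) borel (\<lambda>p. b (snd p))"
proof -
  have "distr (M1 \<Otimes>\<^sub>M M2) borel (\<lambda>p. a (fst p)) = distr M1 borel a"
    using distr_distr[OF a measurable_fst, of M2] by (simp add: distr_fst o_def)
  moreover have "distr (M1 \<Otimes>\<^sub>M M2) borel (\<lambda>p. b (snd p)) = distr M2 borel b"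
    using distr_distr[OF b measurable_snd, of M1] by (simp add: distr_snd o_def)
  moreover have "distr M1 borel a \<Otimes>\<^sub>M distr M2 borel b =
      distr (M1 \<Otimes>\<^sub>M M2) (borel \<Otimes>\<^sub>M borel) (\<lambda>(x, y). (a x, b y))"
    by (intro pair_measure_distr a b) (simp add: prob_space_imp_sigma_finite M2.prob_space_distr)
  ultimately show ?thesis
    unfolding P.indep_var_distribution_eq by (simp add: case_prod_unfold)
qed

lemma
  fixes a :: "'a \<Rightarrow> real" and b :: "'b \<Rightarrow> real"
  assumes a: "integrable M1 a" and b: "integrable M2 b"
  shows integrable_mult_fst_snd: "integrable (M1 \<Otimes>\<^sub>M M2) (\<lambda>p. a (fst p) * b (snd p))"
    and integral_mult_fst_snd:
      "(LINT p|(M1 \<Otimes>\<^sub>M M2). a (fst p) * b (snd p)) = (LINT x|M1. a x) * (LINT y|M2. b y)"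
proof -
  have am[measurable]: "a \<in> borel_measurable M1" and bm[measurable]: "b \<in> borel_measurable M2"
    using a b by auto
  have i: "integrable (M1 \<Otimes>\<^sub>M M2) (\<lambda>p. a (fst p))" "integrable (M1 \<Otimes>\<^sub>M M2) (\<lambda>p. b (snd p))"
    using integrable_distr_eq[OF measurable_fst am, of M2] integrable_distr_eq[OF measurable_snd bm, of M1] a b
    by (simp_all add: distr_fst distr_snd)
  have v: "(LINT p|(M1 \<Otimes>\<^sub>M M2). a (fst p)) = (LINT x|M1. a x)" "(LINT p|(M1 \<Otimes>\<^sub>M M2). b (snd p)) = (LINT y|M2. b y)"
    using integral_distr[OF measurable_fst am, of M2] integral_distr[OF measurable_snd bm, of M1]
    by (simp_all add: distr_fst distr_snd)
  show "integrable (M1 \<Otimes>\<^sub>M M2) (\<lambda>p. a (fst p) * b (snd p))"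
    by (intro P.indep_var_integrable indep_var_functions_fst_snd am bm i)
  show "(LINT p|(M1 \<Otimes>\<^sub>M M2). a (fst p) * b (snd p)) = (LINT x|M1. a x) * (LINT y|M2. b y)"
    using P.indep_var_lebesgue_integral[OF indep_var_functions_fst_snd[OF am bm] i] v by simp
qed

end

context gaussian_measure
begin

text \<open>
  The law of \<open>\<xi> + U g\<close> with \<open>U\<close> standard normal and independent of \<open>\<xi>\<close>. A bounded functional maps
  it to the sum of the independent Gaussian variables \<open>L(\<xi>)\<close> and \<open>U L(g)\<close>, and the mixed terms of the
  covariance vanish since \<open>U\<close> has mean \<open>0\<close>.
\<close>

lemma gaussian_add_noise:
  fixes g :: "'a \<Rightarrow>\<^sub>C (real ^ 'd)"
  obtains \<mu> where "gaussian_measure \<mu>" and "mean_fun \<mu> = mean_fun \<nu>"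
    and "cov_fun \<mu> = (\<lambda>y y'. cov_fun \<nu> y y' + outer (apply_bcontfun g y) (apply_bcontfun g y'))"
proof -
  have prob_UNIV: "measure \<nu> UNIV = 1" using prob_space by simp
  interpret N: real_distribution std_normal_distribution by (rule real_dist_normal_dist)
  interpret pair_prob_space \<nu> std_normal_distribution ..
  define \<Phi> :: "('a \<Rightarrow>\<^sub>C (real ^ 'd)) \<times> real \<Rightarrow> 'a \<Rightarrow>\<^sub>C (real ^ 'd)" where "\<Phi> p = fst p + snd p *\<^sub>R g" for p
  have "continuous_on UNIV \<Phi>" unfolding \<Phi>_def[abs_def] by (intro continuous_intros)
  then have "\<Phi> \<in> borel_measurable (borel \<Otimes>\<^sub>M borel)" by (rule borel_measurable_continuous_pair)
  then have \<Phi>[measurable]: "\<Phi> \<in> borel_measurable (\<nu> \<Otimes>\<^sub>M std_normal_distribution)"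
    by (simp cong: measurable_cong_sets sets_pair_measure_cong)
  define \<mu> where "\<mu> = distr (\<nu> \<Otimes>\<^sub>M std_normal_distribution) borel \<Phi>"
  have gauss: "gaussian_measure \<mu>"
  proof (unfold gaussian_measure_def gaussian_measure_axioms_def, intro conjI allI impI)
    show "sets \<mu> = sets borel" by (simp add: \<mu>_def)
    show "prob_space \<mu>" unfolding \<mu>_def by (rule P.prob_space_distr[OF \<Phi>])
  next
    fix L :: "('a \<Rightarrow>\<^sub>C (real ^ 'd)) \<Rightarrow> real" assume L: "bounded_linear L"
    then have Lm: "L \<in> borel_measurable borel"
      by (intro borel_measurable_continuous_onI linear_continuous_on)
    note [measurable] = measurable_bounded_linear[OF L]
    have X: "distr (\<nu> \<Otimes>\<^sub>M std_normal_distribution) borel (\<lambda>p. L (fst p)) = distr \<nu> borel L"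
      using distr_distr[of L \<nu> borel fst "\<nu> \<Otimes>\<^sub>M std_normal_distribution"] by (simp add: distr_fst o_def)
    have Y: "distr (\<nu> \<Otimes>\<^sub>M std_normal_distribution) borel (\<lambda>p. 0 + L g * snd p) =
       distr std_normal_distribution borel (\<lambda>t. 0 + L g * t)"
      using distr_distr[of "\<lambda>t. 0 + L g * t" std_normal_distribution borel snd "\<nu> \<Otimes>\<^sub>M std_normal_distribution"]
      by (simp add: distr_snd o_def)
    have "distr \<mu> borel L = distr (\<nu> \<Otimes>\<^sub>M std_normal_distribution) borel (\<lambda>p. L (fst p) + (0 + L g * snd p))"
      unfolding \<mu>_def using L
      by (subst distr_distr[OF Lm \<Phi>]) (simp add: o_def \<Phi>_def linear_simps mult.commute)
    moreover have "real_gaussian (distr (\<nu> \<Otimes>\<^sub>M std_normal_distribution) borel (\<lambda>p. L (fst p) + (0 + L g * snd p)))"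
    proof (rule P.real_gaussian_add)
      show "P.indep_var borel (\<lambda>p. L (fst p)) borel (\<lambda>p. 0 + L g * snd p)"
        by (intro indep_var_functions_fst_snd[of L "\<lambda>t. 0 + L g * t"]) auto
      show "real_gaussian (distr (\<nu> \<Otimes>\<^sub>M std_normal_distribution) borel (\<lambda>p. L (fst p)))"
        unfolding X by (rule functional_gaussian[OF L])
      show "real_gaussian (distr (\<nu> \<Otimes>\<^sub>M std_normal_distribution) borel (\<lambda>p. 0 + L g * snd p))"
        unfolding Y real_gaussian_iff_affine_std_normal by blast
    qed
    ultimately show "real_gaussian (distr \<mu> borel L)" by simp
  qed
  then interpret \<mu>: gaussian_measure \<mu> .
  define G where "G y i = apply_bcontfun g y $ i" for y i
  have ev[measurable]: "(\<lambda>f :: 'a \<Rightarrow>\<^sub>C (real ^ 'd). apply_bcontfun f y $ i) \<in> borel_measurable borel" for y i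
    by (intro borel_measurable_continuous_onI linear_continuous_on bounded_linear_eval)
  have int_u: "integrable std_normal_distribution (\<lambda>u. u)" "integrable std_normal_distribution (\<lambda>u. u * u)"
    using integrable_std_normal_distribution_moment[of 1] integrable_std_normal_distribution_moment[of 2]
    by (simp_all add: power2_eq_square)
  have val_u: "(LINT u|std_normal_distribution. u) = 0" "(LINT u|std_normal_distribution. u * u) = 1"
    using integral_std_normal_distribution_moment_odd[of 1] std_normal_distribution_even_moments(1)[of 1]
    by (simp_all add: power2_eq_square)
  note ia = integrable_functional[OF bounded_linear_eval]
  note iaa = integrable_functional_mult[OF bounded_linear_eval bounded_linear_eval]
  have "mean_fun \<mu> y $ i = mean_fun \<nu> y $ i" for y i
  proof -
    have "mean_fun \<mu> y $ i = (LINT p|(\<nu> \<Otimes>\<^sub>M std_normal_distribution).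
        apply_bcontfun (fst p) y $ i * 1 + G y i * snd p)"
      unfolding \<mu>.mean_fun_nth unfolding \<mu>_def
      by (subst integral_distr[OF \<Phi> ev]) (simp add: \<Phi>_def G_def mult.commute)
    also have "\<dots> = mean_fun \<nu> y $ i"
      using integrable_mult_fst_snd[OF ia, of "\<lambda>_. 1"] integral_mult_fst_snd[OF ia, of "\<lambda>_. 1"]
        integrable_mult_fst_snd[of "\<lambda>_. G y i" "\<lambda>u. u"] integral_mult_fst_snd[of "\<lambda>_. G y i" "\<lambda>u. u"]
      using N.prob_space by (simp add: int_u val_u mean_fun_nth)
    finally show ?thesis .
  qed
  then have mean: "mean_fun \<mu> = mean_fun \<nu>" by (auto simp: vec_eq_iff)
  have "cov_fun \<mu> y y' $ i $ j = cov_fun \<nu> y y' $ i $ j + G y i * G y' j" for y y' i j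
  proof -
    define a b where "a f = apply_bcontfun f y $ i" and "b f = apply_bcontfun f y' $ j"
      for f :: "'a \<Rightarrow>\<^sub>C (real ^ 'd)"
    have iab: "integrable \<nu> a" "integrable \<nu> b" "integrable \<nu> (\<lambda>f. a f * b f)"
      using ia iaa by (auto simp: a_def[abs_def] b_def[abs_def])
    have one: "integrable std_normal_distribution (\<lambda>_. 1::real)" by simp
    have c: "integrable \<nu> (\<lambda>_. G y i * G y' j)" by simp
    have "(LINT f|\<mu>. apply_bcontfun f y $ i * apply_bcontfun f y' $ j) =
       (LINT p|(\<nu> \<Otimes>\<^sub>M std_normal_distribution). (a (fst p) * b (fst p)) * 1 + (G y' j * (a (fst p) * snd p) +
          (G y i * (b (fst p) * snd p) + (G y i * G y' j) * (snd p * snd p))))"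
      unfolding \<mu>_def
      by (subst integral_distr[OF \<Phi>]) (auto simp: \<Phi>_def G_def a_def b_def algebra_simps)
    also have "\<dots> = (LINT f|\<nu>. a f * b f) + G y i * G y' j"
      using integrable_mult_fst_snd[OF iab(3) one] integral_mult_fst_snd[OF iab(3) one]
        integrable_mult_fst_snd[OF iab(1) int_u(1)] integral_mult_fst_snd[OF iab(1) int_u(1)]
        integrable_mult_fst_snd[OF iab(2) int_u(1)] integral_mult_fst_snd[OF iab(2) int_u(1)]
        integrable_mult_fst_snd[OF c int_u(2)] integral_mult_fst_snd[OF c int_u(2)]
      using prob_UNIV N.prob_space by (simp add: val_u)
    finally have "(LINT f|\<mu>. apply_bcontfun f y $ i * apply_bcontfun f y' $ j) =
      (LINT f|\<nu>. apply_bcontfun f y $ i * apply_bcontfun f y' $ j) + G y i * G y' j"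
      by (simp only: a_def b_def)
    then show ?thesis unfolding \<mu>.cov_fun_nth cov_fun_nth mean by simp
  qed
  then have "cov_fun \<mu> = (\<lambda>y y'. cov_fun \<nu> y y' + outer (apply_bcontfun g y) (apply_bcontfun g y'))"
    by (intro ext) (simp add: vec_eq_iff outer_def G_def)
  then show thesis using that gauss mean by blast
qed

end

text \<open>
  A vector of independent standard normal variables, added one coordinate at a time so that only
  products with the real line occur.
\<close>

lemma gaussian_add_finite_noise:
  fixes e :: "'i \<Rightarrow> ('a::metric_space \<Rightarrow>\<^sub>C (real ^ 'd))"
  assumes "finite J" and \<nu>: "gaussian_measure \<nu>"
  shows "\<exists>\<mu>. gaussian_measure \<mu> \<and> mean_fun \<mu> = mean_fun \<nu> \<and>
    cov_fun \<mu> = (\<lambda>y y'. cov_fun \<nu> y y' + (\<Sum>j\<in>J. outer (apply_bcontfun (e j) y) (apply_bcontfun (e j) y')))"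
  using assms(1)
proof (induction J)
  case empty
  show ?case using \<nu> by (intro exI[of _ \<nu>]) auto
next
  case (insert j J)
  then obtain \<mu> where \<mu>: "gaussian_measure \<mu>" "mean_fun \<mu> = mean_fun \<nu>"
    "cov_fun \<mu> = (\<lambda>y y'. cov_fun \<nu> y y' + (\<Sum>j\<in>J. outer (apply_bcontfun (e j) y) (apply_bcontfun (e j) y')))"
    by blast
  obtain \<mu>' where "gaussian_measure \<mu>'" "mean_fun \<mu>' = mean_fun \<mu>"
    "cov_fun \<mu>' = (\<lambda>y y'. cov_fun \<mu> y y' + outer (apply_bcontfun (e j) y) (apply_bcontfun (e j) y'))"
    using gaussian_measure.gaussian_add_noise[OF \<mu>(1)] by blast
  then show ?case using insert.hyps \<mu>(2,3) by (intro exI[of _ \<mu>']) (auto simp: fun_eq_iff algebra_simps)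
qed

section \<open>The conditional law\<close>

lemma compact_UNIV_bcontfunE:
  fixes F :: "'a::metric_space \<Rightarrow> 'b::real_normed_vector"
  assumes "compact (UNIV :: 'a set)" "continuous_on UNIV F"
  obtains f where "\<And>y. apply_bcontfun f y = F y"
proof -
  have "F \<in> bcontfun"
    using assms by (simp add: bcontfun_def compact_continuous_image compact_imp_bounded)
  then show thesis using that bcontfunE by metis
qed

context gaussian_measure
begin

lemma transpose_Sigma_mat: "transpose (Sigma_mat \<tau> \<nu> x) = Sigma_mat \<tau> \<nu> x"
proof -
  have "transpose (A + B) = transpose A + transpose B" for A B :: "real ^ 'd ^ 'd"
    by (simp add: transpose_def vec_eq_iff)
  then show ?thesis by (simp add: Sigma_mat_def transpose_cov_fun matrix_transpose_mul)
qed

text \<open>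
  The measure is the law of \<open>\<xi>(y) + G(y)(z - \<xi>(x)) + G(y)\<tau>(x)U\<close> with \<open>G(y) = k(y,x)S\<close>, where \<open>S\<close> is
  the pseudo-inverse of \<open>\<Sigma>(x)\<close>; the sign of \<open>U\<close> does not matter for the law. The noise and the terms
  quadratic in \<open>G\<close> combine to \<open>k(y,x) S \<Sigma>(x) S k(x,y') = k(y,x) S k(x,y')\<close>, which cancels one of the
  two mixed terms.
\<close>

lemma conditional_gaussian_exists:
  fixes \<tau> :: "'a \<Rightarrow> real ^ 'd ^ 'd"
  assumes comp: "compact (UNIV :: 'a set)"
  shows "\<exists>\<mu>. gaussian_measure \<mu> \<and> mean_fun \<mu> = cond_mean \<tau> x z \<nu> \<and> cov_fun \<mu> = cond_cov \<tau> x \<nu>"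
proof -
  define S where "S = pinv (Sigma_mat \<tau> \<nu> x)"
  have S: "S ** Sigma_mat \<tau> \<nu> x ** S = S" "transpose S = S"
    using is_pinv_pinv[OF transpose_Sigma_mat] transpose_pinv_symmetric[OF transpose_Sigma_mat]
    by (auto simp: S_def is_pinv_def)
  define G where "G y = cov_fun \<nu> y x ** S" for y
  note cont_mult = bounded_bilinear.continuous_on[OF bounded_bilinear_matrix_matrix_mult]
  have "continuous_on UNIV ((\<lambda>p. cov_fun \<nu> (fst p) (snd p)) \<circ> (\<lambda>y. (y, x)))"
    by (intro continuous_on_compose continuous_intros continuous_on_subset[OF continuous_cov_fun]) auto
  then have "continuous_on UNIV (\<lambda>y. cov_fun \<nu> y x)" by (simp add: o_def)
  then have G: "continuous_on UNIV G" unfolding G_def[abs_def] by (intro cont_mult continuous_on_const)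
  have col: "continuous_on UNIV (\<lambda>y. column i (M y))" if "continuous_on UNIV M" for M :: "'a \<Rightarrow> real ^ 'd ^ 'd" and i
    unfolding column_def by (intro continuous_intros that)
  have "\<exists>f. \<forall>y. apply_bcontfun f y = column i (G y)" for i
    by (rule compact_UNIV_bcontfunE[OF comp col[OF G, of i]]) blast
  then obtain g where g: "\<And>i y. apply_bcontfun (g i) y = column i (G y)" by metis
  have "\<exists>f. \<forall>y. apply_bcontfun f y = column i (G y ** \<tau> x)" for i
    by (rule compact_UNIV_bcontfunE[OF comp col[of "\<lambda>y. G y ** \<tau> x" i]])
      (use G in \<open>auto intro!: cont_mult continuous_on_const\<close>)
  then obtain e where e: "\<And>i y. apply_bcontfun (e i) y = column i (G y ** \<tau> x)" by metis
  have "continuous_on UNIV (\<lambda>y. G y *v z)"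
    by (intro bounded_bilinear.continuous_on[OF bounded_bilinear_matrix_vector_mult] G continuous_on_const)
  then obtain h where h: "\<And>y. apply_bcontfun h y = G y *v z"
    using compact_UNIV_bcontfunE[OF comp] by metis
  obtain \<mu>0 where \<mu>0: "gaussian_measure \<mu>0"
    "mean_fun \<mu>0 = (\<lambda>y. mean_fun \<nu> y - G y *v mean_fun \<nu> x + apply_bcontfun h y)"
    "cov_fun \<mu>0 = (\<lambda>y y'. cov_fun \<nu> y y' - G y ** cov_fun \<nu> x y'
      - cov_fun \<nu> y x ** transpose (G y') + G y ** cov_fun \<nu> x x ** transpose (G y'))"
    by (rule gaussian_subtract_evaluation[OF g, where h=h and x=x])
  obtain \<mu> where \<mu>: "gaussian_measure \<mu>" "mean_fun \<mu> = mean_fun \<mu>0"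
    "cov_fun \<mu> = (\<lambda>y y'. cov_fun \<mu>0 y y' + (\<Sum>j\<in>UNIV. outer (apply_bcontfun (e j) y) (apply_bcontfun (e j) y')))"
    using gaussian_add_finite_noise[OF finite[of "UNIV :: 'd set"] \<mu>0(1), of e] by blast
  have "mean_fun \<mu> = cond_mean \<tau> x z \<nu>"
    by (auto simp: \<mu>(2) \<mu>0(2) cond_mean_def fun_eq_iff h G_def S_def[symmetric] matrix_vector_mult_diff_distrib)
  moreover have "cov_fun \<mu> y y' = cond_cov \<tau> x \<nu> y y'" for y y'
  proof -
    define K K' where "K = cov_fun \<nu> y x" and "K' = transpose (cov_fun \<nu> y' x)"
    have K': "cov_fun \<nu> x y' = K'" by (simp add: K'_def transpose_cov_fun)
    have G': "transpose (G y') = S ** K'"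
      by (simp add: G_def matrix_transpose_mul S K'_def)
    have "cov_fun \<mu> y y' = cov_fun \<nu> y y' - K ** S ** K' - K ** (S ** K') +
        (K ** S ** cov_fun \<nu> x x ** (S ** K') + K ** S ** \<tau> x ** (transpose (\<tau> x) ** (S ** K')))"
      by (simp add: \<mu>(3) \<mu>0(3) e outer_sum_columns G' K' matrix_transpose_mul)
        (simp add: G_def K_def algebra_simps)
    also have "K ** S ** cov_fun \<nu> x x ** (S ** K') + K ** S ** \<tau> x ** (transpose (\<tau> x) ** (S ** K'))
        = K ** (S ** Sigma_mat \<tau> \<nu> x ** S) ** K'"
      by (simp add: Sigma_mat_def matrix_add_ldistrib bounded_bilinear.add_left[OF bounded_bilinear_matrix_matrix_mult]
          matrix_mul_assoc)
    also have "K ** (S ** Sigma_mat \<tau> \<nu> x ** S) ** K' = K ** S ** K'"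
      unfolding S(1) ..
    also have "cov_fun \<nu> y y' - K ** S ** K' - K ** (S ** K') + K ** S ** K' = cov_fun \<nu> y y' - K ** S ** K'"
      by (simp add: matrix_mul_assoc)
    finally show ?thesis
      unfolding cond_cov_def K_def K'_def S_def .
  qed
  ultimately show ?thesis using \<mu>(1) by blast
qed

end

section \<open>Convergence of the conditional laws\<close>

text \<open>
  A convergent sequence with its limit is compact, so the function is uniformly continuous on the product
  of the whole space with it.
\<close>

lemma uniform_limit_continuous_parameter:
  fixes \<Phi> :: "'a::metric_space \<times> 'p::metric_space \<Rightarrow> 'b::metric_space"
  assumes comp: "compact (UNIV :: 'a set)" and cont: "continuous_on UNIV \<Phi>" and p: "p \<longlonglongrightarrow> p0"
  shows "uniform_limit UNIV (\<lambda>i y. \<Phi> (y, p i)) (\<lambda>y. \<Phi> (y, p0)) sequentially"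
proof (rule uniform_limitI)
  fix \<epsilon> :: real assume \<epsilon>: "\<epsilon> > 0"
  define K where "K = (UNIV :: 'a set) \<times> insert p0 (range p)"
  have "compact (insert p0 (range p))"
    using compactin_sequence_with_limit[of euclidean p p0 "range p"] p by simp
  then have "compact K"
    unfolding K_def using comp by (rule compact_Times[rotated])
  then have "uniformly_continuous_on K \<Phi>"
    by (rule compact_uniformly_continuous[OF continuous_on_subset[OF cont subset_UNIV]])
  then obtain \<delta> where \<delta>: "\<delta> > 0" "\<And>u v. u \<in> K \<Longrightarrow> v \<in> K \<Longrightarrow> dist v u < \<delta> \<Longrightarrow> dist (\<Phi> v) (\<Phi> u) < \<epsilon>"
    using \<epsilon> unfolding uniformly_continuous_on_def by meson
  show "\<forall>\<^sub>F i in sequentially. \<forall>y\<in>UNIV. dist (\<Phi> (y, p i)) (\<Phi> (y, p0)) < \<epsilon>"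
    using tendstoD[OF p \<delta>(1)]
  proof (eventually_elim, intro ballI)
    fix i and y :: 'a assume "dist (p i) p0 < \<delta>"
    then show "dist (\<Phi> (y, p i)) (\<Phi> (y, p0)) < \<epsilon>"
      by (intro \<delta>(2)) (auto simp: K_def dist_Pair_Pair)
  qed
qed

context gaussian_measure
begin

text \<open>
  \<^const>\<open>GP\<close> is defined by a choice operator, so its properties rest on the existence just shown.
\<close>

lemma
  fixes \<tau> :: "'a \<Rightarrow> real ^ 'd ^ 'd"
  assumes comp: "compact (UNIV :: 'a set)"
  shows Cond_gaussian: "Cond \<tau> x z \<nu> \<in> gaussian_measures"
    and mean_fun_Cond: "mean_fun (Cond \<tau> x z \<nu>) = cond_mean \<tau> x z \<nu>"
    and cov_fun_Cond: "cov_fun (Cond \<tau> x z \<nu>) = cond_cov \<tau> x \<nu>"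
proof -
  have "\<exists>\<mu>. \<mu> \<in> gaussian_measures \<and> mean_fun \<mu> = cond_mean \<tau> x z \<nu> \<and> cov_fun \<mu> = cond_cov \<tau> x \<nu>"
    using conditional_gaussian_exists[OF comp] by (simp add: gaussian_measures_iff)
  then have "Cond \<tau> x z \<nu> \<in> gaussian_measures \<and> mean_fun (Cond \<tau> x z \<nu>) = cond_mean \<tau> x z \<nu> \<and>
      cov_fun (Cond \<tau> x z \<nu>) = cond_cov \<tau> x \<nu>"
    unfolding Cond_def GP_def by (rule someI_ex)
  then show "Cond \<tau> x z \<nu> \<in> gaussian_measures" "mean_fun (Cond \<tau> x z \<nu>) = cond_mean \<tau> x z \<nu>"
    "cov_fun (Cond \<tau> x z \<nu>) = cond_cov \<tau> x \<nu>" by blast+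
qed

lemma continuous_on_mean_fun_compose:
  "continuous_on UNIV a \<Longrightarrow> continuous_on UNIV (\<lambda>q. mean_fun \<nu> (a q))"
  using continuous_on_compose2[OF continuous_mean_fun] by blast

lemma continuous_on_cov_fun_compose:
  assumes "continuous_on UNIV a" "continuous_on UNIV b"
  shows "continuous_on UNIV (\<lambda>q. cov_fun \<nu> (a q) (b q))"
  using continuous_on_compose2[OF continuous_cov_fun continuous_on_Pair[OF assms]] by simp

lemma continuous_Sigma_mat:
  assumes "continuous_on UNIV \<tau>"
  shows "continuous_on UNIV (Sigma_mat \<tau> \<nu>)"
  unfolding Sigma_mat_def[abs_def]
  by (intro continuous_on_add continuous_on_cov_fun_compose continuous_on_id
      bounded_bilinear.continuous_on[OF bounded_bilinear_matrix_matrix_mult]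
      bounded_linear.continuous_on[OF bounded_linear_transpose] assms)

lemma tendsto_pinv_Sigma_mat:
  assumes "continuous_on UNIV \<tau>" and x: "xs \<longlonglongrightarrow> x"
    and rank: "\<And>i. rank (Sigma_mat \<tau> \<nu> (xs i)) = rank (Sigma_mat \<tau> \<nu> x)"
  shows "(\<lambda>i. pinv (Sigma_mat \<tau> \<nu> (xs i))) \<longlonglongrightarrow> pinv (Sigma_mat \<tau> \<nu> x)"
  using continuous_on_tendsto_compose[OF continuous_Sigma_mat[OF assms(1)] x]
  by (intro tendsto_pinv_constant_rank transpose_Sigma_mat rank) auto

lemma uniform_limit_cond_mean:
  assumes comp: "compact (UNIV :: 'a set)" and x: "xs \<longlonglongrightarrow> x" and z: "zs \<longlonglongrightarrow> z"
    and S: "(\<lambda>i. pinv (Sigma_mat \<tau> \<nu> (xs i))) \<longlonglongrightarrow> pinv (Sigma_mat \<tau> \<nu> x)"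
  shows "uniform_limit UNIV (\<lambda>i. cond_mean \<tau> (xs i) (zs i) \<nu>) (cond_mean \<tau> x z \<nu>) sequentially"
proof -
  \<comment> \<open>The parameter is the triple of base point, pseudo-inverse and observed value.\<close>
  define \<Phi> :: "'a \<times> ('a \<times> (real ^ 'd ^ 'd) \<times> (real ^ 'd)) \<Rightarrow> real ^ 'd" where
    "\<Phi> q = mean_fun \<nu> (fst q) + (cov_fun \<nu> (fst q) (fst (snd q)) ** fst (snd (snd q))) *v
      (snd (snd (snd q)) - mean_fun \<nu> (fst (snd q)))" for q
  have "continuous_on UNIV \<Phi>"
    unfolding \<Phi>_def[abs_def]
    by (intro continuous_on_add continuous_on_diff continuous_on_cov_fun_compose continuous_on_mean_fun_compose
      bounded_bilinear.continuous_on[OF bounded_bilinear_matrix_matrix_mult]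
      bounded_bilinear.continuous_on[OF bounded_bilinear_matrix_vector_mult] continuous_on_fst continuous_on_snd continuous_on_id)
  from uniform_limit_continuous_parameter[OF comp this tendsto_Pair[OF x tendsto_Pair[OF S z]]]
  show ?thesis by (simp add: \<Phi>_def cond_mean_def[abs_def])
qed

lemma uniform_limit_cond_cov:
  assumes comp: "compact (UNIV :: 'a set)" and x: "xs \<longlonglongrightarrow> x"
    and S: "(\<lambda>i. pinv (Sigma_mat \<tau> \<nu> (xs i))) \<longlonglongrightarrow> pinv (Sigma_mat \<tau> \<nu> x)"
  shows "uniform_limit UNIV (\<lambda>i (y, y'). cond_cov \<tau> (xs i) \<nu> y y') (\<lambda>(y, y'). cond_cov \<tau> x \<nu> y y') sequentially"
proof -
  define \<Phi> :: "('a \<times> 'a) \<times> ('a \<times> (real ^ 'd ^ 'd)) \<Rightarrow> real ^ 'd ^ 'd" where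
    "\<Phi> q = cov_fun \<nu> (fst (fst q)) (snd (fst q)) - cov_fun \<nu> (fst (fst q)) (fst (snd q)) ** snd (snd q) **
      transpose (cov_fun \<nu> (snd (fst q)) (fst (snd q)))" for q
  have "continuous_on UNIV \<Phi>"
    unfolding \<Phi>_def[abs_def]
    by (intro continuous_on_diff continuous_on_cov_fun_compose
      bounded_bilinear.continuous_on[OF bounded_bilinear_matrix_matrix_mult]
      bounded_linear.continuous_on[OF bounded_linear_transpose] continuous_on_fst continuous_on_snd continuous_on_id)
  moreover have "compact (UNIV :: ('a \<times> 'a) set)"
    using compact_Times[OF comp comp] by simp
  ultimately have "uniform_limit UNIV (\<lambda>i q. \<Phi> (q, (xs i, pinv (Sigma_mat \<tau> \<nu> (xs i)))))
      (\<lambda>q. \<Phi> (q, (x, pinv (Sigma_mat \<tau> \<nu> x)))) sequentially"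
    by (intro uniform_limit_continuous_parameter tendsto_Pair x S)
  then show ?thesis by (simp add: \<Phi>_def cond_cov_def case_prod_unfold)
qed

end

theorem proposition3p3:
  fixes \<tau> :: "'a::metric_space \<Rightarrow> real ^ 'd ^ 'd"
    and \<nu> :: "('a \<Rightarrow>\<^sub>C (real ^ 'd)) measure"
    and r :: nat
    and xs :: "nat \<Rightarrow> 'a" and x :: 'a
    and zs :: "nat \<Rightarrow> real ^ 'd" and z :: "real ^ 'd"
  assumes "compact (UNIV :: 'a::metric_space set)"
    and "continuous_on UNIV \<tau>"
    and "\<nu> \<in> gaussian_measures"
    and "r \<in> {1..CARD('d)}"
    and "\<And>i. xs i \<in> rank_stratum \<tau> \<nu> r"
    and "x \<in> rank_stratum \<tau> \<nu> r"
    and "(\<lambda>i. (xs i, zs i)) \<longlonglongrightarrow> (x, z)"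
  shows "gaussian_converges (\<lambda>i. Cond \<tau> (xs i) (zs i) \<nu>) (Cond \<tau> x z \<nu>)"
proof -
  interpret gaussian_measure \<nu> using assms(3) by (simp add: gaussian_measures_iff)
  have x: "xs \<longlonglongrightarrow> x" and z: "zs \<longlonglongrightarrow> z"
    using tendsto_fst[OF assms(7)] tendsto_snd[OF assms(7)] by simp_all
  have "rank (Sigma_mat \<tau> \<nu> (xs i)) = rank (Sigma_mat \<tau> \<nu> x)" for i
    using assms(5)[of i] assms(6) by (simp add: rank_stratum_def)
  then have S: "(\<lambda>i. pinv (Sigma_mat \<tau> \<nu> (xs i))) \<longlonglongrightarrow> pinv (Sigma_mat \<tau> \<nu> x)"
    by (intro tendsto_pinv_Sigma_mat assms(2) x)
  show ?thesis
    unfolding gaussian_converges_def mean_fun_Cond[OF assms(1)] cov_fun_Cond[OF assms(1)]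
    using Cond_gaussian[OF assms(1)] uniform_limit_cond_mean[OF assms(1) x z S]
      uniform_limit_cond_cov[OF assms(1) x S] by auto
qed

end
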